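(* There is a continuous function $Q:[{}^\omega2]^3_{E_2}\to{}^\omega2$ such that for every $E_2$-tree $p$, $Q[[[p]]^3_{E_2}]={}^\omega2$. There is a $\Delta^1_1$ function $K:{}^3({}^\omega2)\to{}^\omega2$ such that for every $\Sigma^1_1$ set $A\subseteq{}^\omega2$ with $E_2\le_{\Delta^1_1}E_2\upharpoonright A$, $K[[A]^3_{E_2}]={}^\omega2$.
   Context: For $x,y\in{}^N2$ and $m<n\le N\le\omega$, $\delta_m^n(x,y)=\sum\{\frac1{k+1}:m\le k<n,\ x(k)\neq y(k)\}$; $\delta=\delta_0^\omega$. $E_2$ on ${}^\omega2$: $x\,E_2\,y$ iff $\delta(x,y)<\infty$. For $A\subseteq{}^\omega2$, $[A]^3_{E_2}=\{(x_0,x_1,x_2)\in{}^3A:(\forall i\neq j)\neg(x_i\,E_2\,x_j)\}$. An $E_2$-tree is a tree $p\subseteq{}^{<\omega}2$ that is the downward closure of $g[{}^{<\omega}2]$ for some strictly increasing $(m_k:k\in\omega)$ with $m_0=0$ and $g:{}^{<\omega}2\to{}^{<\omega}2$ such that: $|g(s)|=m_{|s|}$; $s\subseteq t\Rightarrow g(s)\subseteq g(t)$; if $|s|=|t|=k>0$ and $s(k-1)=t(k-1)$ then $\delta_{m_{k-1}}^{m_k}(g(s),g(t))<2^{-(k+1)}$; if $|s|=|t|=k>0$ and $s(k-1)\neq t(k-1)$ then $|\delta_{m_{k-1}}^{m_k}(g(s),g(t))-\frac1k|<2^{-(k+1)}$; and $\Phi(x)=\bigcup_n g(x\upharpoonright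 n)$ is a $\Delta^1_1$ reduction of $E_2$ to $E_2\upharpoonright[p]$. $[p]$ is the set of branches of $p$. $E\le_{\Delta^1_1}F$ means there is a $\Delta^1_1$ function $\Phi$ with $a\,E\,b\iff\Phi(a)\,F\,\Phi(b)$. *)

theory Defs
  imports "HOL-Analysis.Analysis" "HOL-Library.Sublist"
begin

text \<open>
  The Cantor space is the type \<^typ>\<open>nat \<Rightarrow> bool\<close> with the library's product topology (bool and nat
  carry discrete topologies); finite binary strings are \<^typ>\<open>bool list\<close>.
\<close>

text \<open>
  The pointclasses are the boldface ones: a set is \<open>\<Sigma>\<^sup>1\<^sub>1\<close> if it is the projection of a closed
  subset of its product with the Baire space \<^typ>\<open>nat \<Rightarrow> nat\<close>.
\<close>

definition Sigma11 :: "'a::topological_space set \<Rightarrow> bool" where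
  "Sigma11 A \<longleftrightarrow> (\<exists>C :: ('a \<times> (nat \<Rightarrow> nat)) set. closed C \<and> A = fst ` C)"

definition Pi11 :: "'a::topological_space set \<Rightarrow> bool" where
  "Pi11 A \<longleftrightarrow> Sigma11 (- A)"

definition Delta11 :: "'a::topological_space set \<Rightarrow> bool" where
  "Delta11 A \<longleftrightarrow> Sigma11 A \<and> Pi11 A"

definition Delta11_function :: "('a::topological_space \<Rightarrow> 'b::topological_space) \<Rightarrow> bool" where
  "Delta11_function \<Phi> \<longleftrightarrow> (\<forall>U. open U \<longrightarrow> Delta11 (\<Phi> -` U))"

text \<open>
  \<open>\<Phi>\<close> reduces \<open>E\<close>, an equivalence relation on the whole type, to the restriction of \<open>F\<close> to \<open>B\<close>;
  in particular \<open>\<Phi>\<close> takes values in \<open>B\<close>.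
\<close>

definition Delta11_reduction ::
  "('a::topological_space \<Rightarrow> 'a \<Rightarrow> bool) \<Rightarrow> ('b::topological_space \<Rightarrow> 'b \<Rightarrow> bool) \<Rightarrow> 'b set
    \<Rightarrow> ('a \<Rightarrow> 'b) \<Rightarrow> bool" where
  "Delta11_reduction E F B \<Phi> \<longleftrightarrow>
     Delta11_function \<Phi> \<and> range \<Phi> \<subseteq> B \<and> (\<forall>a b. E a b \<longleftrightarrow> F (\<Phi> a) (\<Phi> b))"

definition Delta11_reducible ::
  "('a::topological_space \<Rightarrow> 'a \<Rightarrow> bool) \<Rightarrow> ('b::topological_space \<Rightarrow> 'b \<Rightarrow> bool) \<Rightarrow> 'b set
    \<Rightarrow> bool" where
  "Delta11_reducible E F B \<longleftrightarrow> (\<exists>\<Phi>. Delta11_reduction E F B \<Phi>)"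

text \<open>\<open>\<delta>\<^sub>m\<^sup>n\<close> for finite strings, used only with \<open>n\<close> at most the length of both strings.\<close>

definition delta_list :: "nat \<Rightarrow> nat \<Rightarrow> bool list \<Rightarrow> bool list \<Rightarrow> real" where
  "delta_list m n s t = (\<Sum>k | m \<le> k \<and> k < n \<and> s ! k \<noteq> t ! k. 1 / (real k + 1))"

text \<open>\<open>\<delta> = \<delta>\<^sub>0\<^sup>\<omega>\<close>, with value \<open>\<infinity>\<close> when the series diverges.\<close>

definition delta :: "(nat \<Rightarrow> bool) \<Rightarrow> (nat \<Rightarrow> bool) \<Rightarrow> ennreal" where
  "delta x y = (\<Sum>\<^sub>\<infinity>k\<in>{k. x k \<noteq> y k}. ennreal (1 / (real k + 1)))"

definition E2 :: "(nat \<Rightarrow> bool) \<Rightarrow> (nat \<Rightarrow> bool) \<Rightarrow> bool" where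
  "E2 x y \<longleftrightarrow> delta x y < \<infinity>"

definition E2_triples ::
  "(nat \<Rightarrow> bool) set \<Rightarrow> ((nat \<Rightarrow> bool) \<times> (nat \<Rightarrow> bool) \<times> (nat \<Rightarrow> bool)) set" where
  "E2_triples A = {(x0, x1, x2). x0 \<in> A \<and> x1 \<in> A \<and> x2 \<in> A \<and>
     \<not> E2 x0 x1 \<and> \<not> E2 x0 x2 \<and> \<not> E2 x1 x0 \<and> \<not> E2 x1 x2 \<and> \<not> E2 x2 x0 \<and> \<not> E2 x2 x1}"

definition restr :: "(nat \<Rightarrow> 'a) \<Rightarrow> nat \<Rightarrow> 'a list" where
  "restr x n = map x [0..<n]"

definition branches :: "bool list set \<Rightarrow> (nat \<Rightarrow> bool) set" where
  "branches p = {x. \<forall>n. restr x n \<in> p}"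

text \<open>
  The map \<open>x \<mapsto> \<Union>\<^sub>n g(x\<restriction>n)\<close>: position \<open>i\<close> carries the entry shared by all the (coherent)
  strings \<open>g(x\<restriction>n)\<close> longer than \<open>i\<close>.
\<close>

definition union_map :: "(bool list \<Rightarrow> bool list) \<Rightarrow> (nat \<Rightarrow> bool) \<Rightarrow> (nat \<Rightarrow> bool)" where
  "union_map g x = (\<lambda>i. THE b. \<exists>n. i < length (g (restr x n)) \<and> g (restr x n) ! i = b)"

definition E2_tree :: "bool list set \<Rightarrow> bool" where
  "E2_tree p \<longleftrightarrow> (\<exists>(m :: nat \<Rightarrow> nat) (g :: bool list \<Rightarrow> bool list).
     strict_mono m \<and> m 0 = 0 \<and>
     p = {u. \<exists>s. prefix u (g s)} \<and>
     (\<forall>s. length (g s) = m (length s)) \<and>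
     (\<forall>s t. prefix s t \<longrightarrow> prefix (g s) (g t)) \<and>
     (\<forall>s t k. length s = k \<and> length t = k \<and> k > 0 \<and> s ! (k - 1) = t ! (k - 1) \<longrightarrow>
        delta_list (m (k - 1)) (m k) (g s) (g t) < 1 / 2 ^ (k + 1)) \<and>
     (\<forall>s t k. length s = k \<and> length t = k \<and> k > 0 \<and> s ! (k - 1) \<noteq> t ! (k - 1) \<longrightarrow>
        \<bar>delta_list (m (k - 1)) (m k) (g s) (g t) - 1 / real k\<bar> < 1 / 2 ^ (k + 1)) \<and>
     Delta11_reduction E2 E2 (branches p) (union_map g))"

end

theory Submission
  imports Defs
begin

text \<open>
  Both functions are the same map \<open>decode\<close>. Let \<open>t\<^sub>j\<close> be the first time at which the partial sum of
  \<open>\<delta>(x,y)\<close> reaches \<open>100 j\<close>; the \<open>i\<close>-th bit says whether \<open>x\<close> and \<open>z\<close> differ substantially (by at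
  least \<open>50\<close>) between \<open>t\<^sub>3\<^sub>i\<close> and \<open>t\<^sub>3\<^sub>i\<^sub>+\<^sub>1\<close>. An \<open>E\<^sub>2\<close>-tree comes with a reduction into its branches, so it
  is enough to decode every point from images under a \<open>\<Delta>\<^sup>1\<^sub>1\<close> reduction \<open>\<Phi>\<close> of \<open>E\<^sub>2\<close> to \<open>E\<^sub>2\<restriction>A\<close>.

  Analytic sets have the Baire property, so \<open>\<Phi>\<close> is continuous on a comeagre set, which may be taken
  closed under finite modifications. On some basic open set, flipping one bit moves the tail of the
  image by at most \<open>1\<close>. Starting from three eventually equal points and flipping bits towards a point
  inequivalent to \<open>x\<close>, one can therefore increase \<open>\<delta>(\<Phi> x, \<Phi> y)\<close> by about \<open>100\<close> while \<open>\<Phi> z\<close> follows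
  either \<open>\<Phi> x\<close> or \<open>\<Phi> y\<close>, at will. Iterating this writes an arbitrary sequence of bits.
\<close>

section \<open>Finite agreement and grafting\<close>

definition agree :: "nat \<Rightarrow> (nat \<Rightarrow> 'a) \<Rightarrow> (nat \<Rightarrow> 'a) \<Rightarrow> bool" where
  "agree n x y \<longleftrightarrow> (\<forall>i<n. x i = y i)"

definition graft :: "nat \<Rightarrow> (nat \<Rightarrow> 'a) \<Rightarrow> (nat \<Rightarrow> 'a) \<Rightarrow> (nat \<Rightarrow> 'a)" where
  "graft n x y = (\<lambda>i. if i < n then x i else y i)"

lemma agree_refl [simp]: "agree n x x"
  by (simp add: agree_def)

lemma agree_0 [simp]: "agree 0 x y"
  by (simp add: agree_def)

lemma agree_sym: "agree n x y \<Longrightarrow> agree n y x"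
  by (simp add: agree_def)

lemma agree_trans: "agree n x y \<Longrightarrow> agree n y z \<Longrightarrow> agree n x z"
  by (simp add: agree_def)

lemma agree_mono: "agree n x y \<Longrightarrow> m \<le> n \<Longrightarrow> agree m x y"
  by (simp add: agree_def)

lemma agree_graft [simp]: "m \<le> n \<Longrightarrow> agree m x (graft n x y)"
  by (simp add: agree_def graft_def)

lemma graft_same [simp]: "graft n x x = x"
  by (simp add: graft_def)

lemma open_agree: "open {y :: nat \<Rightarrow> 'a::discrete_topology. agree n x y}"
proof -
  have "open {y. \<forall>i\<in>{..<n}. y i \<in> {x i}}"
    by (rule product_topology_basis') (auto simp: open_discrete)
  then show ?thesis by (simp add: agree_def Ball_def eq_commute)
qed

lemma open_imp_agree_ball:
  assumes "open U" "x \<in> U"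
  obtains n where "\<And>y :: nat \<Rightarrow> 'a::topological_space. agree n x y \<Longrightarrow> y \<in> U"
proof -
  obtain X where X: "x \<in> (\<Pi>\<^sub>E i\<in>UNIV. X i)" "finite {i. X i \<noteq> UNIV}" "(\<Pi>\<^sub>E i\<in>UNIV. X i) \<subseteq> U"
    using product_topology_open_contains_basis[OF assms(1)[unfolded open_fun_def] assms(2)] by auto
  obtain n where n: "\<forall>i\<in>{i. X i \<noteq> UNIV}. i < n"
    using X(2) by (meson finite_nat_set_iff_bounded)
  show thesis
  proof (rule that)
    fix y assume "agree n x y"
    then have "y \<in> (\<Pi>\<^sub>E i\<in>UNIV. X i)"
      using X(1) n by (auto simp: PiE_def Pi_def agree_def) (metis UNIV_I)
    then show "y \<in> U" using X(3) by auto
  qed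
qed

lemma agree_chain:
  assumes "\<And>j. agree (l j) (X j) (X (Suc j))" "\<And>j. l j \<le> l (Suc j)" "j \<le> k"
  shows "agree (l j) (X j) (X k)"
  using assms(3)
proof (induction k rule: dec_induct)
  case (step k)
  have "l j \<le> l k" using step.hyps assms(2) by (meson lift_Suc_mono_le)
  then show ?case using step.IH assms(1)[of k] agree_mono agree_trans by blast
qed simp

text \<open>Fusion step of the recursive constructions below. Strict growth gives
  \<open>j \<le> l j\<close>, so coordinate \<open>i\<close> is fixed from stage
  \<open>Suc i\<close> on and the diagonal is the limit.\<close>

lemma agree_limit:
  assumes "\<And>j. agree (l j) (X j) (X (Suc j))" "\<And>j. l j < l (Suc j)"
  obtains x where "\<And>j. agree (l j) (X j) x"
proof
  have ge: "j \<le> l j" for j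
  proof (induction j)
    case (Suc j) then show ?case using assms(2)[of j] by linarith
  qed simp
  have mono: "l j \<le> l k" if "j \<le> k" for j k
    by (rule lift_Suc_mono_le[OF _ that]) (simp add: assms(2) less_imp_le)
  fix j
  show "agree (l j) (X j) (\<lambda>i. X (Suc i) i)"
    unfolding agree_def
  proof (intro allI impI)
    fix i assume i: "i < l j"
    have "agree (l (min j (Suc i))) (X (min j (Suc i))) (X (max j (Suc i)))"
      by (rule agree_chain[of l X, OF assms(1) less_imp_le[OF assms(2)]]) simp
    moreover have "i < l (min j (Suc i))" using i ge[of "Suc i"] by (auto simp: min_def)
    ultimately show "X j i = X (Suc i) i" by (auto simp: agree_def min_def max_def split: if_splits)
  qed
qed

section \<open>Partial sums of the metric and their relation to \<open>E\<^sub>2\<close>\<close>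

definition pdelta :: "nat \<Rightarrow> nat \<Rightarrow> (nat \<Rightarrow> bool) \<Rightarrow> (nat \<Rightarrow> bool) \<Rightarrow> real" where
  "pdelta m n x y = (\<Sum>k\<in>{m..<n}. if x k \<noteq> y k then 1 / (real k + 1) else 0)"

lemma pdelta_nonneg: "0 \<le> pdelta m n x y"
  by (auto simp: pdelta_def intro: sum_nonneg)

lemma pdelta_self [simp]: "pdelta m n x x = 0"
  by (simp add: pdelta_def)

lemma pdelta_empty [simp]: "n \<le> m \<Longrightarrow> pdelta m n x y = 0"
  by (simp add: pdelta_def)

lemma pdelta_sym: "pdelta m n x y = pdelta m n y x"
  unfolding pdelta_def by (rule sum.cong) auto

lemma pdelta_triangle: "pdelta m n x z \<le> pdelta m n x y + pdelta m n y z"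
  unfolding pdelta_def sum.distrib[symmetric] by (rule sum_mono) auto

lemma pdelta_split: "m \<le> k \<Longrightarrow> k \<le> n \<Longrightarrow> pdelta m n x y = pdelta m k x y + pdelta k n x y"
  unfolding pdelta_def by (simp add: sum.atLeastLessThan_concat)

lemma pdelta_mono: "m' \<le> m \<Longrightarrow> n \<le> n' \<Longrightarrow> pdelta m n x y \<le> pdelta m' n' x y"
  unfolding pdelta_def by (rule sum_mono2) auto

lemma pdelta_agree:
  "agree n x x' \<Longrightarrow> agree n y y' \<Longrightarrow> pdelta m n x y = pdelta m n x' y'"
  unfolding pdelta_def agree_def by (rule sum.cong) auto

lemma pdelta_single:
  assumes "\<And>i. i \<noteq> p \<Longrightarrow> x i = y i"
  shows "pdelta m n x y \<le> 1 / (real p + 1)"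
proof -
  have "pdelta m n x y \<le> (\<Sum>k\<in>{m..<n}. if p = k then 1 / (real k + 1) else 0)"
    unfolding pdelta_def using assms by (intro sum_mono) auto
  also have "\<dots> \<le> 1 / (real p + 1)" by (simp add: sum.delta)
  finally show ?thesis .
qed

text \<open>Against the complement every coordinate counts, so the sums are blocks of the harmonic
  series; a bound \<open>B\<close> would bound all harmonic numbers.\<close>

lemma pdelta_Not_unbounded: "\<exists>n. B \<le> pdelta m n x (\<lambda>i. \<not> x i)"
proof (rule ccontr)
  assume *: "\<not> ?thesis"
  have harm: "harm n \<le> B + harm m" for n :: nat
  proof (cases "m \<le> n")
    case True
    have "(harm n :: real) = harm m + pdelta m n x (\<lambda>i. \<not> x i)"
      using sum.atLeastLessThan_concat[of 0 m n "\<lambda>k. inverse (real (Suc k))"] True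
      unfolding harm_altdef pdelta_def
      by (simp add: lessThan_atLeast0 inverse_eq_divide add.commute)
    moreover have "pdelta m n x (\<lambda>i. \<not> x i) < B" using * by (simp add: not_le)
    ultimately show ?thesis by simp
  next
    case False
    have "0 \<le> B" using * by (metis pdelta_empty order_refl nle_le)
    moreover have "harm n \<le> (harm m :: real)" using harm_mono[of n m] False by simp
    ultimately show ?thesis by simp
  qed
  have "convergent (harm :: nat \<Rightarrow> real)"
  proof (rule Bseq_monoseq_convergent)
    show "Bseq (harm :: nat \<Rightarrow> real)"
      by (rule BseqI'[of _ "B + harm m"]) (simp add: harm)
    show "monoseq (harm :: nat \<Rightarrow> real)" by (simp add: monoseq_def harm_mono)
  qed
  then show False using not_convergent_harm by blast
qed

text \<open>The \<open>ennreal\<close> sum is a supremum over finite sets, and every finite set lies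
  in an initial segment. From here on \<open>E2\<close> is handled through real partial sums
  only.\<close>

lemma E2_iff_bounded: "E2 x y \<longleftrightarrow> (\<exists>B. \<forall>n. pdelta 0 n x y \<le> B)"
proof -
  let ?A = "{k. x k \<noteq> y k}"
  let ?f = "\<lambda>k::nat. 1 / (real k + 1)"
  have eq: "pdelta 0 n x y = sum ?f (?A \<inter> {..<n})" for n
    unfolding pdelta_def by (simp add: sum.If_cases atLeast0LessThan Int_commute)
  have d: "delta x y = (SUP F\<in>{F. finite F \<and> F \<subseteq> ?A}. ennreal (sum ?f F))"
    unfolding delta_def by (subst nonneg_infsum_complete) (auto simp: sum_ennreal)
  show ?thesis
  proof
    assume "E2 x y"
    then have fin: "delta x y < \<infinity>" by (simp add: E2_def)
    have "pdelta 0 n x y \<le> enn2real (delta x y)" for n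
    proof -
      have "ennreal (sum ?f (?A \<inter> {..<n})) \<le> delta x y"
        unfolding d by (rule SUP_upper) auto
      then show ?thesis
        using fin enn2real_mono[of "ennreal (sum ?f (?A \<inter> {..<n}))" "delta x y"]
        by (simp add: eq sum_nonneg)
    qed
    then show "\<exists>B. \<forall>n. pdelta 0 n x y \<le> B" by blast
  next
    assume "\<exists>B. \<forall>n. pdelta 0 n x y \<le> B"
    then obtain B where B: "\<And>n. pdelta 0 n x y \<le> B" by blast
    have "delta x y \<le> ennreal B"
      unfolding d
    proof (rule SUP_least)
      fix F assume "F \<in> {F. finite F \<and> F \<subseteq> ?A}"
      then have F: "finite F" "F \<subseteq> ?A" by auto
      then obtain n where "F \<subseteq> {..<n}" by (meson finite_nat_iff_bounded)
      then have "sum ?f F \<le> sum ?f (?A \<inter> {..<n})" using F by (intro sum_mono2) auto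
      then show "ennreal (sum ?f F) \<le> ennreal B" using B[of n] eq[of n] by (intro ennreal_leI) linarith
    qed
    then show "E2 x y" unfolding E2_def by (simp add: le_less_trans[OF _ ennreal_less_top])
  qed
qed

lemma E2_bounded_tail:
  assumes "\<And>n. pdelta m n x y \<le> B"
  shows "E2 x y"
  unfolding E2_iff_bounded
proof (intro exI allI)
  fix n
  have "0 \<le> B" using assms[of m] by simp
  then show "pdelta 0 n x y \<le> pdelta 0 m x y + B"
    using assms[of n] pdelta_split[of 0 m n x y] pdelta_mono[of 0 0 n m x y]
    by (cases "m \<le> n") auto
qed

lemma E2_sym: "E2 x y \<Longrightarrow> E2 y x"
  by (simp add: E2_iff_bounded pdelta_sym[of _ _ y])

lemma E2_trans:
  assumes "E2 x y" "E2 y z"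
  shows "E2 x z"
proof -
  obtain B C where "\<And>n. pdelta 0 n x y \<le> B" "\<And>n. pdelta 0 n y z \<le> C"
    using assms unfolding E2_iff_bounded by blast
  then have "pdelta 0 n x z \<le> B + C" for n
    using pdelta_triangle[of 0 n x z y] by (meson add_mono order_trans)
  then show ?thesis unfolding E2_iff_bounded by blast
qed

lemma pdelta_le_add_tail: "pdelta 0 N x y \<le> pdelta 0 n x y + pdelta n N x y"
proof (cases "n \<le> N")
  case True
  then show ?thesis using pdelta_split[of 0 n N x y] by simp
next
  case False
  then show ?thesis using pdelta_mono[of 0 0 N n x y] by simp
qed

lemma E2_eventually_equal: "(\<And>i. l \<le> i \<Longrightarrow> x i = y i) \<Longrightarrow> E2 x y"
  by (rule E2_bounded_tail[of l _ _ 0]) (simp add: pdelta_def)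

lemma E2_tail_small:
  assumes "E2 x y" "0 < e"
  obtains n where "n0 \<le> n" "\<And>N. pdelta n N x y \<le> e"
proof -
  obtain B where B: "\<And>n. pdelta 0 n x y \<le> B" using assms(1) E2_iff_bounded by blast
  define S where "S = (SUP n. pdelta 0 n x y)"
  have bdd: "bdd_above (range (\<lambda>n. pdelta 0 n x y))" using B by (auto simp: bdd_above_def)
  obtain n1 where n1: "S - e < pdelta 0 n1 x y"
    using assms(2) less_cSUP_iff[OF _ bdd, of "S - e"] unfolding S_def by auto
  let ?n = "max n0 n1"
  have "pdelta ?n N x y \<le> e" for N
  proof (cases "?n \<le> N")
    case True
    have "pdelta 0 N x y \<le> S" unfolding S_def using bdd by (rule cSUP_upper[rotated]) simp
    moreover have "pdelta 0 n1 x y \<le> pdelta 0 ?n x y" by (rule pdelta_mono) auto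
    ultimately show ?thesis using pdelta_split[of 0 ?n N x y] True n1 by simp
  next
    case False
    then have "pdelta ?n N x y = 0" by (intro pdelta_empty) (rule nat_le_linear[THEN disjE], auto)
    then show ?thesis using assms(2) by simp
  qed
  then show thesis by (intro that[of ?n]) auto
qed

text \<open>Failure of the Cauchy criterion. The constructions below certify inequivalence in this
  form, because a block of fixed weight survives the passage to a limit.\<close>

lemma not_E2_if_cofinal_jumps:
  assumes "0 < e" "\<And>n. \<exists>m N. n \<le> m \<and> e \<le> pdelta m N x y"
  shows "\<not> E2 x y"
proof
  assume "E2 x y"
  then obtain n where n: "\<And>N. pdelta n N x y \<le> e / 2"
    using E2_tail_small[of x y "e/2" 0] assms(1) by auto
  obtain m N where "n \<le> m" "e \<le> pdelta m N x y" using assms(2) by blast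
  then show False using pdelta_mono[of n m N N x y] n[of N] assms(1) by auto
qed

section \<open>Category in the Cantor space\<close>

definition open_dense :: "(nat \<Rightarrow> bool) set \<Rightarrow> bool" where
  "open_dense U \<longleftrightarrow> (\<forall>x\<in>U. \<exists>n. \<forall>y. agree n x y \<longrightarrow> y \<in> U) \<and> (\<forall>x n. \<exists>y. agree n x y \<and> y \<in> U)"

definition meagre :: "(nat \<Rightarrow> bool) set \<Rightarrow> bool" where
  "meagre S \<longleftrightarrow> (\<exists>U :: nat \<Rightarrow> _. (\<forall>k. open_dense (U k)) \<and> S \<inter> (\<Inter>k. U k) = {})"

text \<open>Indexing cylinders by strings makes them a countable family, as \<open>meagre_UN\<close>
  demands.\<close>

definition cyl :: "bool list \<Rightarrow> (nat \<Rightarrow> bool) set" where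
  "cyl w = {y. agree (length w) (nth w) y}"

lemma cyl_restr: "cyl (restr x n) = {y. agree n x y}"
  by (auto simp: cyl_def restr_def agree_def)

lemma open_dense_ball:
  assumes "open_dense U" "x \<in> U"
  obtains n where "m \<le> n" "\<And>y. agree n x y \<Longrightarrow> y \<in> U"
proof -
  obtain n where "\<forall>y. agree n x y \<longrightarrow> y \<in> U" using assms unfolding open_dense_def by blast
  then show thesis using that[of "max m n"] agree_mono by (metis max.cobounded1 max.cobounded2)
qed

lemma open_dense_dense: "open_dense U \<Longrightarrow> \<exists>y. agree n x y \<and> y \<in> U"
  by (simp add: open_dense_def)

lemma Baire:
  assumes U: "\<And>k. open_dense (U k)"
  obtains y where "agree n x y" "\<And>k :: nat. y \<in> U k"
proof -
  \<comment> \<open>A state is a cylinder, given by its centre and its length. \<open>P\<close>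
    places it inside \<open>U k\<close> and \<open>Q\<close> nests it in its predecessor, so the
    limit point lies in every \<open>U k\<close>.\<close>
  define P where "P k s \<longleftrightarrow> agree n x (fst s) \<and> n \<le> snd s \<and> (\<forall>y. agree (snd s) (fst s) y \<longrightarrow> y \<in> U k)"
    for k and s :: "(nat \<Rightarrow> bool) \<times> nat"
  define Q where "Q s t \<longleftrightarrow> agree (snd s) (fst s) (fst t) \<and> snd s < snd t"
    for s t :: "(nat \<Rightarrow> bool) \<times> nat"
  have "\<exists>f. \<forall>k. P k (f k) \<and> Q (f k) (f (Suc k))"
  proof (rule dependent_nat_choice)
    obtain z where z: "agree n x z" "z \<in> U 0" using open_dense_dense[OF U] by blast
    obtain m where "n \<le> m" "\<And>y. agree m z y \<Longrightarrow> y \<in> U 0" using open_dense_ball[OF U z(2)] by metis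
    then show "\<exists>s. P 0 s" using z by (intro exI[of _ "(z, m)"]) (simp add: P_def)
  next
    fix s k assume s: "P k s"
    obtain z where z: "agree (snd s) (fst s) z" "z \<in> U (Suc k)" using open_dense_dense[OF U] by blast
    obtain m where "Suc (snd s) \<le> m" "\<And>y. agree m z y \<Longrightarrow> y \<in> U (Suc k)"
      using open_dense_ball[OF U z(2)] by metis
    moreover have "agree n x z"
      using s z(1) unfolding P_def by (meson agree_mono agree_trans)
    ultimately show "\<exists>t. P (Suc k) t \<and> Q s t" using z s
      by (intro exI[of _ "(z, m)"]) (simp add: P_def Q_def)
  qed
  then obtain f where f: "\<And>k. P k (f k)" "\<And>k. Q (f k) (f (Suc k))" by blast
  obtain y where y: "\<And>j. agree (snd (f j)) (fst (f j)) y"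
    using agree_limit[of "\<lambda>j. snd (f j)" "\<lambda>j. fst (f j)"] f(2) unfolding Q_def by metis
  show thesis
  proof
    have "agree n x (fst (f 0))" "n \<le> snd (f 0)" using f(1)[of 0] by (auto simp: P_def)
    then show "agree n x y" using y[of 0] by (meson agree_mono agree_trans)
    show "y \<in> U k" for k using f(1)[of k] y[of k] by (auto simp: P_def)
  qed
qed

lemma meagre_subset: "meagre T \<Longrightarrow> S \<subseteq> T \<Longrightarrow> meagre S"
  unfolding meagre_def by blast

lemma meagre_UN:
  assumes "\<And>i :: 'i::countable. meagre (S i)"
  shows "meagre (\<Union>i. S i)"
proof -
  have "\<forall>i. \<exists>U :: nat \<Rightarrow> _. (\<forall>k. open_dense (U k)) \<and> S i \<inter> (\<Inter>k. U k) = {}"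
    using assms unfolding meagre_def by blast
  then obtain U :: "'i \<Rightarrow> nat \<Rightarrow> _" where
    U: "\<And>i k. open_dense (U i k)" "\<And>i. S i \<inter> (\<Inter>k. U i k) = {}"
    by metis
  let ?V = "\<lambda>n. case from_nat n of (i, k) \<Rightarrow> U i k"
  have "?V (to_nat (i, k)) = U i k" for i k by simp
  then have "(\<Inter>n. ?V n) \<subseteq> U i k" for i k by (metis INT_lower UNIV_I)
  then have "(\<Inter>n. ?V n) \<subseteq> (\<Inter>k. U i k)" for i by (rule INT_greatest)
  then have "S i \<inter> (\<Inter>n. ?V n) \<subseteq> S i \<inter> (\<Inter>k. U i k)" for i by (rule Int_mono[OF order_refl])
  then have "S i \<inter> (\<Inter>n. ?V n) = {}" for i unfolding U(2) by (rule subset_empty[THEN iffD1])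
  then have "(\<Union>i. S i) \<inter> (\<Inter>n. ?V n) = {}" by (metis (no_types, lifting) IntI UN_E disjoint_iff)
  moreover have "open_dense (?V n)" for n by (simp add: U(1) split: prod.split)
  ultimately show ?thesis unfolding meagre_def by (intro exI[of _ ?V]) simp
qed

lemma meagre_Un: "meagre S \<Longrightarrow> meagre T \<Longrightarrow> meagre (S \<union> T)"
  by (rule meagre_subset[OF meagre_UN[of "\<lambda>b::bool. if b then S else T"]])
    (auto simp: UNIV_bool)

lemma meagre_empty [simp]: "meagre {}"
  unfolding meagre_def by (intro exI[of _ "\<lambda>_. UNIV"]) (auto simp: open_dense_def intro: agree_refl)

lemma meagre_disjoint_open_dense: "open_dense U \<Longrightarrow> S \<inter> U = {} \<Longrightarrow> meagre S"
  unfolding meagre_def by (intro exI[of _ "\<lambda>_. U"]) simp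

text \<open>The union of all cylinders in which \<open>S\<close> is meagre, hence an open set. If
  \<open>S\<close> has the Baire property, the complement of this set equals \<open>S\<close> up to
  a meagre set.\<close>

definition local_meagre :: "(nat \<Rightarrow> bool) set \<Rightarrow> (nat \<Rightarrow> bool) set" where
  "local_meagre S = {x. \<exists>n. meagre (S \<inter> {y. agree n x y})}"

lemma local_meagre_open:
  assumes "x \<in> local_meagre S"
  obtains n where "\<And>y. agree n x y \<Longrightarrow> y \<in> local_meagre S"
proof -
  obtain n where n: "meagre (S \<inter> {y. agree n x y})" using assms by (auto simp: local_meagre_def)
  have "y \<in> local_meagre S" if "agree n x y" for y
  proof -
    have "{z. agree n y z} = {z. agree n x z}" using that by (auto simp: agree_def)
    then show ?thesis using n unfolding local_meagre_def mem_Collect_eq by metis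
  qed
  then show thesis using that by blast
qed

text \<open>Banach category theorem: a set is meagre in the union of the open sets in which it is
  meagre. Only countably many cylinders are involved, so a countable union suffices.\<close>

lemma meagre_Int_local_meagre: "meagre (S \<inter> local_meagre S)"
proof (rule meagre_subset)
  show "meagre (\<Union>w. if meagre (S \<inter> cyl w) then S \<inter> cyl w else {})"
    by (rule meagre_UN) simp
  show "S \<inter> local_meagre S \<subseteq> (\<Union>w. if meagre (S \<inter> cyl w) then S \<inter> cyl w else {})"
  proof
    fix x assume x: "x \<in> S \<inter> local_meagre S"
    then obtain n where "meagre (S \<inter> cyl (restr x n))" by (auto simp: local_meagre_def cyl_restr)
    moreover have "x \<in> S \<inter> cyl (restr x n)" using x by (simp add: cyl_restr)
    ultimately show "x \<in> (\<Union>w. if meagre (S \<inter> cyl w) then S \<inter> cyl w else {})"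
      by (intro UN_I[of "restr x n"]) auto
  qed
qed

text \<open>Together with the complement of the cylinder, \<open>local_meagre S\<close> is open and
  dense, so the rest of the cylinder is meagre. The part of \<open>S\<close> inside it is covered by
  \<open>meagre_Int_local_meagre\<close>.\<close>

lemma meagre_if_local_meagre_dense:
  assumes "\<And>y m. agree n x y \<Longrightarrow> n \<le> m \<Longrightarrow> \<exists>z. agree m y z \<and> z \<in> local_meagre S"
  shows "meagre (S \<inter> {y. agree n x y})"
proof -
  let ?B = "{y. agree n x y}"
  have "open_dense (local_meagre S \<union> - ?B)"
    unfolding open_dense_def
  proof (intro conjI ballI allI)
    fix y assume "y \<in> local_meagre S \<union> - ?B"
    then consider "y \<in> local_meagre S" | "\<not> agree n x y" by blast
    then show "\<exists>m. \<forall>z. agree m y z \<longrightarrow> z \<in> local_meagre S \<union> - ?B"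
    proof cases
      case 1
      then show ?thesis using local_meagre_open by (metis UnI1)
    next
      case 2
      then have "\<forall>z. agree n y z \<longrightarrow> z \<in> - ?B" using agree_sym agree_trans by blast
      then show ?thesis by blast
    qed
  next
    fix y m
    show "\<exists>z. agree m y z \<and> z \<in> local_meagre S \<union> - ?B"
    proof (cases "agree n x y")
      case True
      then obtain z where "agree (max n m) y z" "z \<in> local_meagre S"
        using assms[of y "max n m"] by auto
      then show ?thesis using agree_mono by (metis UnI1 max.cobounded2)
    next
      case False
      then show ?thesis by (intro exI[of _ y]) simp
    qed
  qed
  then have "meagre (?B - local_meagre S)" by (rule meagre_disjoint_open_dense) blast
  then show ?thesis
    by (rule meagre_subset[OF meagre_Un[OF meagre_Int_local_meagre[of S]]]) blast
qed

text \<open>Suslin scheme: \<open>S s\<close> projects the part of \<open>C\<close> whose second coordinate extends \<open>s\<close>. A point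
  outside the meagre set \<open>\<Union>s. Q s\<close> that is not locally meagre at the root stays so along a branch,
  and then lies in \<open>A\<close> because \<open>C\<close> is closed.\<close>

lemma Sigma11_Baire_property:
  assumes "Sigma11 (A :: (nat \<Rightarrow> bool) set)"
  obtains M where "meagre M" "\<And>x. x \<notin> M \<Longrightarrow> x \<in> A \<longleftrightarrow> x \<notin> local_meagre A"
proof -
  obtain C :: "((nat \<Rightarrow> bool) \<times> (nat \<Rightarrow> nat)) set" where C: "closed C" "A = fst ` C"
    using assms unfolding Sigma11_def by blast
  define S where "S s = {x. \<exists>f. (x, f) \<in> C \<and> agree (length s) (nth s) f}" for s :: "nat list"
  define W where "W s = local_meagre (S s)" for s
  define Q where "Q s = - W s \<inter> (\<Inter>k. W (s @ [k]))" for s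
  have S_split: "S s = (\<Union>k. S (s @ [k]))" for s
  proof -
    have "agree (length s) ((!) s) f \<longleftrightarrow> agree (Suc (length s)) (nth (s @ [k])) f" if "k = f (length s)" for f k
      using that by (auto simp: agree_def nth_append less_Suc_eq)
    moreover have "agree (length s) ((!) s) f" if "agree (Suc (length s)) (nth (s @ [k])) f" for f k
      using that by (auto simp: agree_def nth_append less_Suc_eq split: if_splits)
    ultimately show ?thesis unfolding S_def by fastforce
  qed
  have A: "A = S []" unfolding S_def C by force
  \<comment> \<open>If every subcylinder of some cylinder met \<open>Q s\<close>, each
    \<open>S (s @ [k])\<close> would be meagre there, hence so would their union \<open>S s\<close>,
    although points of \<open>Q s\<close> lie outside \<open>W s\<close>.\<close>
  have nwd: "\<exists>y m. agree n x y \<and> n \<le> m \<and> {z. agree m y z} \<inter> Q s = {}" for s x n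
  proof (rule ccontr)
    assume neg: "\<not> ?thesis"
    have "meagre (S (s @ [k]) \<inter> {y. agree n x y})" for k
    proof (rule meagre_if_local_meagre_dense)
      fix y m assume "agree n x y" "n \<le> m"
      then obtain z where "agree m y z" "z \<in> Q s" using neg by blast
      then show "\<exists>z. agree m y z \<and> z \<in> local_meagre (S (s @ [k]))"
        unfolding Q_def W_def by blast
    qed
    then have "meagre (S s \<inter> {y. agree n x y})"
      unfolding S_split[of s] Int_commute[of "\<Union>_"] Int_UN_distrib
      by (intro meagre_UN) (simp add: Int_commute)
    moreover obtain z where z: "agree n x z" "z \<in> Q s" using neg agree_refl order_refl by blast
    moreover have "{y. agree n x y} = {y. agree n z y}" using z(1) by (auto simp: agree_def)
    ultimately have "z \<in> W s" unfolding W_def local_meagre_def by auto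
    then show False using z(2) by (simp add: Q_def)
  qed
  have "meagre (Q s)" for s
  proof (rule meagre_disjoint_open_dense)
    let ?U = "{x. \<exists>n. {z. agree n x z} \<inter> Q s = {}}"
    show "Q s \<inter> ?U = {}" using agree_refl by blast
    show "open_dense ?U"
      unfolding open_dense_def
    proof (intro conjI ballI allI)
      fix x assume "x \<in> ?U"
      then obtain n where n: "{z. agree n x z} \<inter> Q s = {}" by blast
      have "{z. agree n y z} \<inter> Q s = {}" if "agree n x y" for y
        using n that agree_trans by blast
      then show "\<exists>n. \<forall>y. agree n x y \<longrightarrow> y \<in> ?U" by blast
    next
      fix x n
      show "\<exists>y. agree n x y \<and> y \<in> ?U" using nwd[of n x s] by blast
    qed
  qed
  then have mQ: "meagre (\<Union>s. Q s)" by (rule meagre_UN)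
  have key: "x \<in> A" if "x \<notin> W []" "x \<notin> (\<Union>s. Q s)" for x
  proof -
    have "\<exists>f. \<forall>n. (length (f n) = n \<and> x \<notin> W (f n)) \<and> (\<exists>k. f (Suc n) = f n @ [k])"
    proof (rule dependent_nat_choice)
      show "\<exists>s. length s = 0 \<and> x \<notin> W s" using that by (intro exI[of _ "[]"]) simp
      fix s :: "nat list" and n assume s: "length s = n \<and> x \<notin> W s"
      have "x \<notin> Q s" using that by blast
      then obtain k where "x \<notin> W (s @ [k])" using s unfolding Q_def by blast
      then show "\<exists>t. (length t = Suc n \<and> x \<notin> W t) \<and> (\<exists>k. t = s @ [k])" using s
        by (intro exI[of _ "s @ [k]"]) simp
    qed
    then obtain F where F: "\<And>n. length (F n) = n" "\<And>n. x \<notin> W (F n)" "\<And>n. \<exists>k. F (Suc n) = F n @ [k]"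
      by blast
    define h where "h i = F (Suc i) ! i" for i
    have h: "agree n (nth (F n)) h" for n
    proof (induction n)
      case (Suc n)
      obtain k where k: "F (Suc n) = F n @ [k]" using F(3) by blast
      show ?case using Suc unfolding agree_def less_Suc_eq
        by (auto simp: k nth_append F(1) h_def)
    qed simp
    have "(x, h) \<in> C"
    proof (rule ccontr)
      assume "(x, h) \<notin> C"
      then obtain T1 T2 where T: "open T1" "open T2" "x \<in> T1" "h \<in> T2" "T1 \<times> T2 \<subseteq> - C"
        using C(1) by (metis ComplI closed_def mem_Sigma_iff open_prod_elim)
      obtain a where a: "\<And>y. agree a x y \<Longrightarrow> y \<in> T1" using open_imp_agree_ball[OF T(1,3)] by blast
      obtain b where b: "\<And>y. agree b h y \<Longrightarrow> y \<in> T2" using open_imp_agree_ball[OF T(2,4)] by blast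
      \<comment> \<open>No point of \<open>C\<close> over this cylinder has a second coordinate
        extending \<open>F b\<close>. The empty set is meagre, which puts \<open>x\<close> into
        \<open>W (F b)\<close>.\<close>
      have "S (F b) \<inter> {y. agree a x y} = {}"
      proof -
        have False if "(y, f) \<in> C" "agree b (nth (F b)) f" "agree a x y" for y f
        proof -
          have "agree b h f" using that(2) h[of b] agree_sym agree_trans by blast
          then show False using a b that T(5) by blast
        qed
        then show ?thesis by (auto simp: S_def F(1))
      qed
      then have "x \<in> W (F b)" unfolding W_def local_meagre_def by (auto intro!: exI[of _ a])
      then show False using F(2) by blast
    qed
    then show "x \<in> A" using C(2) by force
  qed
  show thesis
  proof
    show "meagre ((A \<inter> local_meagre A) \<union> (\<Union>s. Q s))"
      by (rule meagre_Un[OF meagre_Int_local_meagre mQ])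
    show "x \<in> A \<longleftrightarrow> x \<notin> local_meagre A" if "x \<notin> (A \<inter> local_meagre A) \<union> (\<Union>s. Q s)" for x
      using that key[of x] by (auto simp: W_def A)
  qed
qed

text \<open>On a comeagre set, having image bit \<open>b\<close> at \<open>i\<close> means lying
  outside an open set. Applied to the opposite bit, this makes each image bit locally constant
  there.\<close>

lemma Delta11_function_continuous_on_comeagre:
  fixes \<Phi> :: "(nat \<Rightarrow> bool) \<Rightarrow> (nat \<Rightarrow> bool)"
  assumes "Delta11_function \<Phi>"
  obtains U :: "nat \<Rightarrow> (nat \<Rightarrow> bool) set" where "\<And>k. open_dense (U k)"
    "\<And>x m. x \<in> (\<Inter>k. U k) \<Longrightarrow> \<exists>n. \<forall>y\<in>(\<Inter>k. U k). agree n x y \<longrightarrow> agree m (\<Phi> x) (\<Phi> y)"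
proof -
  let ?A = "\<lambda>i b. {x. \<Phi> x i = b}"
  have S: "Sigma11 (?A i b)" for i b
  proof -
    have "open {y :: nat \<Rightarrow> bool. y i = b}"
      using open_vimage[OF open_discrete[of "{b}"] continuous_on_product_coordinates[of i]]
      by (simp add: vimage_def)
    then have "Delta11 (\<Phi> -` {y. y i = b})" using assms unfolding Delta11_function_def by blast
    then show ?thesis by (simp add: Delta11_def vimage_def)
  qed
  have "\<forall>i b. \<exists>M. meagre M \<and> (\<forall>x. x \<notin> M \<longrightarrow> (x \<in> ?A i b \<longleftrightarrow> x \<notin> local_meagre (?A i b)))"
    using Sigma11_Baire_property[OF S] by metis
  then obtain M where M: "\<And>i b. meagre (M i b)"
    "\<And>i b x. x \<notin> M i b \<Longrightarrow> (x \<in> ?A i b \<longleftrightarrow> x \<notin> local_meagre (?A i b))"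
    by metis
  have "meagre (\<Union>i. \<Union>b. M i b)" by (intro meagre_UN M)
  then obtain U :: "nat \<Rightarrow> (nat \<Rightarrow> bool) set" where U: "\<And>k. open_dense (U k)"
    "(\<Union>i. \<Union>b. M i b) \<inter> (\<Inter>k. U k) = {}"
    unfolding meagre_def by blast
  have eq: "\<Phi> x i = b \<longleftrightarrow> x \<notin> local_meagre (?A i b)" if "x \<in> (\<Inter>k. U k)" for x i b
    using M(2)[of x i b] U(2) that by blast
  have "\<exists>n. \<forall>y\<in>(\<Inter>k. U k). agree n x y \<longrightarrow> agree m (\<Phi> x) (\<Phi> y)" if x: "x \<in> (\<Inter>k. U k)" for x m
  proof (induction m)
    case (Suc m)
    then obtain n where n: "\<forall>y\<in>(\<Inter>k. U k). agree n x y \<longrightarrow> agree m (\<Phi> x) (\<Phi> y)" by blast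
    have "x \<in> local_meagre (?A m (\<not> \<Phi> x m))" using eq[OF x, of m "\<not> \<Phi> x m"] by auto
    then obtain n' where n': "\<And>y. agree n' x y \<Longrightarrow> y \<in> local_meagre (?A m (\<not> \<Phi> x m))"
      using local_meagre_open by blast
    have "agree (Suc m) (\<Phi> x) (\<Phi> y)" if y: "y \<in> (\<Inter>k. U k)" "agree (max n n') x y" for y
    proof -
      have "agree m (\<Phi> x) (\<Phi> y)" using n y agree_mono by (metis max.cobounded1)
      moreover have "y \<in> local_meagre (?A m (\<not> \<Phi> x m))" using n' y(2) agree_mono by (metis max.cobounded2)
      then have "\<Phi> y m \<noteq> (\<not> \<Phi> x m)" using eq[OF y(1), of m "\<not> \<Phi> x m"] by blast
      ultimately show ?thesis by (auto simp: agree_def less_Suc_eq)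
    qed
    then show ?case by blast
  qed simp
  then show thesis using that U(1) by blast
qed

section \<open>Comeagre sets closed under finite modification\<close>

lemma graft_graft: "graft n a (graft m b x) = graft (max n m) (graft n a b) x"
  by (auto simp: graft_def fun_eq_iff)

lemma graft_restr: "graft (length (restr a n)) (nth (restr a n)) x = graft n a x"
  by (auto simp: graft_def restr_def)

lemma open_dense_graft_vimage:
  assumes U: "open_dense U"
  shows "open_dense {x. graft m a x \<in> U}"
  unfolding open_dense_def
proof (intro conjI ballI allI)
  fix x assume "x \<in> {x. graft m a x \<in> U}"
  then obtain n where n: "\<And>y. agree n (graft m a x) y \<Longrightarrow> y \<in> U"
    using open_dense_ball[OF U] by (metis mem_Collect_eq)
  have "graft m a y \<in> U" if "agree n x y" for y
    by (rule n) (use that in \<open>auto simp: agree_def graft_def\<close>)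
  then show "\<exists>n. \<forall>y. agree n x y \<longrightarrow> y \<in> {x. graft m a x \<in> U}" by blast
next
  fix x n
  obtain z where z: "agree (max n m) (graft m a x) z" "z \<in> U" using open_dense_dense[OF U] by blast
  have "graft m a (graft (max n m) x z) = z"
  proof
    fix i
    have "i < max n m \<Longrightarrow> graft m a x i = z i" using z(1) by (simp add: agree_def)
    then show "graft m a (graft (max n m) x z) i = z i" by (cases "i < max n m") (auto simp: graft_def)
  qed
  then show "\<exists>y. agree n x y \<and> y \<in> {x. graft m a x \<in> U}"
    using z(2) by (intro exI[of _ "graft (max n m) x z"]) simp
qed

text \<open>The new set consists of the points all of whose finite modifications lie in every
  \<open>U i\<close>. Prefixes are coded by strings, so countably many open dense sets define
  it.\<close>

lemma invariant_comeagre_subset: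
  fixes U :: "'i::countable \<Rightarrow> (nat \<Rightarrow> bool) set"
  assumes U: "\<And>i. open_dense (U i)"
  obtains V :: "nat \<Rightarrow> (nat \<Rightarrow> bool) set" where "\<And>k. open_dense (V k)" "(\<Inter>k. V k) \<subseteq> (\<Inter>i. U i)"
    "\<And>n x w. w \<in> (\<Inter>k. V k) \<Longrightarrow> graft n x w \<in> (\<Inter>k. V k)"
proof -
  define F where "F = (\<lambda>(i, b). {x. graft (length b) (nth b) x \<in> U i})"
  define V where "V k = F (from_nat k)" for k
  have F: "open_dense (F p)" for p
    unfolding F_def by (cases p) (simp add: open_dense_graft_vimage U)
  have mem: "x \<in> (\<Inter>k. V k) \<longleftrightarrow> (\<forall>i n a. graft n a x \<in> U i)" for x
  proof
    assume x: "x \<in> (\<Inter>k. V k)"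
    have "x \<in> F (i, restr a n)" for i n a
    proof -
      have "x \<in> V (to_nat (i, restr a n))" using x by blast
      then show ?thesis by (simp add: V_def)
    qed
    then show "\<forall>i n a. graft n a x \<in> U i" by (simp add: F_def graft_restr)
  next
    assume "\<forall>i n a. graft n a x \<in> U i"
    then show "x \<in> (\<Inter>k. V k)" by (simp add: V_def F_def split: prod.split)
  qed
  show thesis
  proof (rule that[of V])
    show "open_dense (V k)" for k by (simp add: V_def F)
    show "(\<Inter>k. V k) \<subseteq> (\<Inter>i. U i)"
    proof
      fix x assume "x \<in> (\<Inter>k. V k)"
      from mem[THEN iffD1, OF this] have "graft 0 x x \<in> U i" for i by blast
      then show "x \<in> (\<Inter>i. U i)" by (simp add: graft_def)
    qed
    show "graft n x w \<in> (\<Inter>k. V k)" if "w \<in> (\<Inter>k. V k)" for n x w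
    proof -
      have "graft m a (graft n x w) \<in> U i" for i m a
        using mem[THEN iffD1, OF that] by (simp add: graft_graft)
      then show ?thesis unfolding mem by blast
    qed
  qed
qed

section \<open>Reductions that are continuous on an invariant comeagre set\<close>

text \<open>\<open>stable\<close> is a genericity condition: for fixed \<open>y\<close>-prefix and \<open>n\<close>, the points where the tail
  bound holds form a relatively closed set, and \<open>G\<close> avoids the boundaries of these countably many
  sets.\<close>

locale tame_reduction =
  fixes \<Phi> :: "(nat \<Rightarrow> bool) \<Rightarrow> (nat \<Rightarrow> bool)" and U :: "nat \<Rightarrow> (nat \<Rightarrow> bool) set"
    and G :: "(nat \<Rightarrow> bool) set"
  assumes U_open_dense: "\<And>k. open_dense (U k)"
    and G_eq: "G = (\<Inter>k. U k)"
    and graft_in_G: "\<And>n x w. w \<in> G \<Longrightarrow> graft n x w \<in> G"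
    and continuous: "\<And>x m. x \<in> G \<Longrightarrow> \<exists>n. \<forall>y\<in>G. agree n x y \<longrightarrow> agree m (\<Phi> x) (\<Phi> y)"
    and reduction: "\<And>x y. E2 x y \<longleftrightarrow> E2 (\<Phi> x) (\<Phi> y)"
    and stable: "\<And>x y l n. x \<in> G \<Longrightarrow> y \<in> G \<Longrightarrow> (\<And>i. l \<le> i \<Longrightarrow> x i = y i) \<Longrightarrow>
      (\<And>N. pdelta n N (\<Phi> x) (\<Phi> y) \<le> 1) \<Longrightarrow>
      \<exists>l'. \<forall>w\<in>G. agree l' x w \<longrightarrow> (\<forall>N. pdelta n N (\<Phi> w) (\<Phi> (graft l y w)) \<le> 1)"

text \<open>Genericity is obtained in two rounds: \<open>\<Phi>\<close> is continuous on
  \<open>H\<close>, and this continuity then gives the density of the sets \<open>D n b\<close>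
  behind stability.\<close>

lemma tame_reduction_exists:
  assumes "Delta11_reduction E2 E2 A \<Phi>"
  shows "\<exists>U G. tame_reduction \<Phi> U G"
proof -
  have "Delta11_function \<Phi>" using assms by (simp add: Delta11_reduction_def)
  then obtain U0 :: "nat \<Rightarrow> _" where U0: "\<And>k. open_dense (U0 k)"
    "\<And>x m. x \<in> (\<Inter>k. U0 k) \<Longrightarrow> \<exists>n. \<forall>y\<in>(\<Inter>k. U0 k). agree n x y \<longrightarrow> agree m (\<Phi> x) (\<Phi> y)"
    using Delta11_function_continuous_on_comeagre by blast
  obtain V :: "nat \<Rightarrow> (nat \<Rightarrow> bool) set" where V: "\<And>k. open_dense (V k)" "(\<Inter>k. V k) \<subseteq> (\<Inter>k. U0 k)"
    "\<And>n x w. w \<in> (\<Inter>k. V k) \<Longrightarrow> graft n x w \<in> (\<Inter>k. V k)"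
    using invariant_comeagre_subset[of U0] U0(1) by metis
  define H where "H = (\<Inter>k. V k)"
  have Hcont: "\<exists>n. \<forall>y\<in>H. agree n x y \<longrightarrow> agree m (\<Phi> x) (\<Phi> y)" if "x \<in> H" for x m
    using U0(2)[of x m] V(2) that unfolding H_def by (meson subsetD)
  have Hgraft: "graft n x w \<in> H" if "w \<in> H" for n x w using V(3) that unfolding H_def .
  define S where "S n b w \<longleftrightarrow> (\<forall>N. pdelta n N (\<Phi> w) (\<Phi> (graft (length b) (nth b) w)) \<le> 1)"
    for n and b :: "bool list" and w
  \<comment> \<open>Near a point of \<open>D n b\<close> the bound \<open>S n b\<close> is decided
    on \<open>H\<close>. For density: a failure of the bound shows in a finite partial sum, so
    continuity preserves it nearby.\<close>
  define D where "D n b = {x. \<exists>m. (\<forall>w\<in>H. agree m x w \<longrightarrow> S n b w) \<or> (\<forall>w\<in>H. agree m x w \<longrightarrow> \<not> S n b w)}"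
    for n b
  have D: "open_dense (D n b)" for n b
    unfolding open_dense_def
  proof (intro conjI ballI allI)
    fix x assume "x \<in> D n b"
    then obtain m where
      "(\<forall>w\<in>H. agree m x w \<longrightarrow> S n b w) \<or> (\<forall>w\<in>H. agree m x w \<longrightarrow> \<not> S n b w)"
      unfolding D_def by blast
    then have "\<forall>y. agree m x y \<longrightarrow> y \<in> D n b" unfolding D_def using agree_trans by blast
    then show "\<exists>m. \<forall>y. agree m x y \<longrightarrow> y \<in> D n b" by blast
  next
    fix x k
    obtain z where z: "agree k x z" "\<And>j. z \<in> V j" using Baire[of V k x] V(1) by metis
    have z: "agree k x z" "z \<in> H" using z by (simp_all add: H_def)
    show "\<exists>y. agree k x y \<and> y \<in> D n b"
    proof (cases "\<forall>w\<in>H. agree k z w \<longrightarrow> S n b w")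
      case True
      then show ?thesis using z(1) unfolding D_def by blast
    next
      case False
      let ?g = "graft (length b) (nth b)"
      obtain w where w: "w \<in> H" "agree k z w" "\<not> S n b w" using False by blast
      then obtain N where N: "1 < pdelta n N (\<Phi> w) (\<Phi> (?g w))" unfolding S_def by (meson not_le)
      obtain p where p: "\<forall>y\<in>H. agree p w y \<longrightarrow> agree N (\<Phi> w) (\<Phi> y)" using Hcont[OF w(1)] by blast
      obtain q where q: "\<forall>y\<in>H. agree q (?g w) y \<longrightarrow> agree N (\<Phi> (?g w)) (\<Phi> y)"
        using Hcont[OF Hgraft[OF w(1)]] by blast
      have "\<not> S n b y" if y: "y \<in> H" "agree (max p q) w y" for y
      proof -
        have "agree q (?g w) (?g y)" using y(2) by (auto simp: agree_def graft_def)
        then have "agree N (\<Phi> (?g w)) (\<Phi> (?g y))" using q Hgraft y(1) by blast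
        moreover have "agree N (\<Phi> w) (\<Phi> y)" using p y agree_mono by (metis max.cobounded1)
        ultimately have "1 < pdelta n N (\<Phi> y) (\<Phi> (?g y))" using N pdelta_agree by metis
        then show ?thesis unfolding S_def by (meson not_le)
      qed
      then have "w \<in> D n b" unfolding D_def by blast
      then show ?thesis using z(1) w(2) agree_trans by blast
    qed
  qed
  define F where "F = (\<lambda>s :: nat + nat \<times> bool list. case s of Inl k \<Rightarrow> V k | Inr (n, b) \<Rightarrow> D n b)"
  have F: "open_dense (F s)" for s unfolding F_def by (auto simp: V(1) D split: sum.split)
  obtain W :: "nat \<Rightarrow> (nat \<Rightarrow> bool) set" where W: "\<And>k. open_dense (W k)" "(\<Inter>k. W k) \<subseteq> (\<Inter>s. F s)"
    "\<And>n x w. w \<in> (\<Inter>k. W k) \<Longrightarrow> graft n x w \<in> (\<Inter>k. W k)"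
    using invariant_comeagre_subset[of F] F by metis
  define G where "G = (\<Inter>k. W k)"
  have FG: "x \<in> F s" if "x \<in> G" for x s using W(2) that unfolding G_def by blast
  have GH: "x \<in> H" if "x \<in> G" for x
  proof -
    have "x \<in> V k" for k using FG[OF that, of "Inl k"] by (simp add: F_def)
    then show ?thesis by (simp add: H_def)
  qed
  have GD: "x \<in> D n b" if "x \<in> G" for x n b using FG[OF that, of "Inr (n, b)"] by (simp add: F_def)
  have "tame_reduction \<Phi> W G"
  proof
    show "open_dense (W k)" for k by (rule W(1))
    show "G = (\<Inter>k. W k)" by (rule G_def)
    show "graft n x w \<in> G" if "w \<in> G" for n x w using W(3) that unfolding G_def .
    show "\<exists>n. \<forall>y\<in>G. agree n x y \<longrightarrow> agree m (\<Phi> x) (\<Phi> y)" if "x \<in> G" for x m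
      using Hcont[OF GH[OF that]] GH by meson
    show "E2 x y \<longleftrightarrow> E2 (\<Phi> x) (\<Phi> y)" for x y
      using assms by (simp add: Delta11_reduction_def)
    fix x y l n
    assume x: "x \<in> G" and y: "y \<in> G" "\<And>i. l \<le> i \<Longrightarrow> x i = y i"
      and t: "\<And>N. pdelta n N (\<Phi> x) (\<Phi> y) \<le> 1"
    have g: "graft (length (restr y l)) (nth (restr y l)) x = y"
      unfolding graft_restr using y(2) by (auto simp: graft_def)
    have "S n (restr y l) x" unfolding S_def g using t by blast
    then obtain m where "\<forall>w\<in>H. agree m x w \<longrightarrow> S n (restr y l) w"
      using GD[OF x, of n "restr y l"] GH[OF x] agree_refl[of _ x] unfolding D_def by blast
    then show "\<exists>l'. \<forall>w\<in>G. agree l' x w \<longrightarrow> (\<forall>N. pdelta n N (\<Phi> w) (\<Phi> (graft l y w)) \<le> 1)"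
      using GH unfolding S_def graft_restr by blast
  qed
  then show ?thesis by blast
qed

context tame_reduction
begin

text \<open>What a fusion stage has to fix: the first conjunct forces limits into every
  \<open>U k\<close>, thus into \<open>G\<close>; the second fixes \<open>n\<close> image bits and
  so carries bounds on image distances to the limit.\<close>

definition settled :: "nat \<Rightarrow> nat \<Rightarrow> nat \<Rightarrow> (nat \<Rightarrow> bool) \<Rightarrow> bool" where
  "settled k n l x \<longleftrightarrow> (\<forall>w. agree l x w \<longrightarrow> w \<in> U k) \<and> (\<forall>w\<in>G. agree l x w \<longrightarrow> agree n (\<Phi> x) (\<Phi> w))"

lemma settled_mono: "settled k n l x \<Longrightarrow> l \<le> l' \<Longrightarrow> settled k n l' x"
  unfolding settled_def using agree_mono by blast

lemma settledD: "settled k n l x \<Longrightarrow> w \<in> G \<Longrightarrow> agree l x w \<Longrightarrow> agree n (\<Phi> x) (\<Phi> w)"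
  unfolding settled_def by blast

lemma settled_exists:
  assumes "x \<in> G"
  shows "\<exists>l. settled k n l x"
proof -
  obtain p where p: "\<And>y. agree p x y \<Longrightarrow> y \<in> U k"
    using open_dense_ball[OF U_open_dense] assms unfolding G_eq by (metis INT_E UNIV_I)
  obtain q where q: "\<forall>y\<in>G. agree q x y \<longrightarrow> agree n (\<Phi> x) (\<Phi> y)" using continuous[OF assms] by blast
  have "settled k n (max p q) x"
    unfolding settled_def using p q agree_mono by (meson max.cobounded1 max.cobounded2)
  then show ?thesis by blast
qed

lemma settled_limit:
  assumes "\<And>j. settled j (n j) (l j) (X j)" "\<And>j. agree (l j) (X j) x"
  shows "x \<in> G" "agree (n j) (\<Phi> (X j)) (\<Phi> x)"
proof -
  have "x \<in> U j" for j using assms unfolding settled_def by blast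
  then show "x \<in> G" by (simp add: G_eq)
  then show "agree (n j) (\<Phi> (X j)) (\<Phi> x)" using settledD assms by blast
qed

lemma G_nonempty: obtains x where "x \<in> G"
proof -
  obtain x where "\<And>k. x \<in> U k" using Baire[of U 0 undefined] U_open_dense by metis
  then show thesis by (intro that[of x]) (simp add: G_eq)
qed

text \<open>The complement of \<open>x\<close> need not lie in \<open>G\<close>. The fusion
  alternates between disagreeing with \<open>x\<close> on a block of weight at least
  \<open>1\<close> and shrinking into the next \<open>U k\<close>.\<close>

lemma E2_inequivalent_neighbour:
  assumes "x \<in> G"
  obtains v where "v \<in> G" "agree l x v" "\<not> E2 x v"
proof -
  define P where "P k s \<longleftrightarrow> fst s \<in> G \<and> agree l x (fst s) \<and> l \<le> snd s \<and> settled k 0 (snd s) (fst s)"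
    for k and s :: "(nat \<Rightarrow> bool) \<times> nat"
  define Q where "Q s t \<longleftrightarrow> agree (snd s) (fst s) (fst t) \<and> snd s < snd t \<and>
      1 \<le> pdelta (snd s) (snd t) x (fst t)"
    for s t :: "(nat \<Rightarrow> bool) \<times> nat"
  have "\<exists>f. \<forall>k. P k (f k) \<and> Q (f k) (f (Suc k))"
  proof (rule dependent_nat_choice)
    obtain m where "settled 0 0 m x" using settled_exists[OF assms] by blast
    then have "settled 0 0 (max l m) x" using settled_mono by simp
    then show "\<exists>s. P 0 s" using assms by (intro exI[of _ "(x, max l m)"]) (simp add: P_def)
  next
    fix s k assume s: "P k s"
    obtain v m where vm: "s = (v, m)" by fastforce
    obtain n where n: "1 \<le> pdelta m n x (\<lambda>i. \<not> x i)" using pdelta_Not_unbounded by blast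
    then have mn: "m < n" by (metis not_le pdelta_empty not_one_le_zero)
    \<comment> \<open>Complementing \<open>x\<close> on the block from \<open>m\<close> to
      \<open>n\<close> is a finite modification of \<open>v\<close>, so \<open>v'\<close> stays in
      \<open>G\<close>; keeping the bits below \<open>m\<close> preserves the earlier
      stages.\<close>
    define v' where "v' = graft m v (graft n (\<lambda>i. \<not> x i) v)"
    have v': "v' \<in> G" using s graft_in_G by (simp add: v'_def P_def vm)
    obtain q where "settled (Suc k) 0 q v'" using settled_exists[OF v'] by blast
    then have st: "settled (Suc k) 0 (max n q) v'" using settled_mono by simp
    have "pdelta m n x v' = pdelta m n x (\<lambda>i. \<not> x i)"
      unfolding pdelta_def by (rule sum.cong) (auto simp: v'_def graft_def)
    then have "1 \<le> pdelta m (max n q) x v'"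
      using n pdelta_mono[of m m n "max n q" x v'] by simp
    moreover have "agree l x v'"
      using s unfolding P_def vm v'_def by (auto simp: agree_def graft_def)
    ultimately show "\<exists>t. P (Suc k) t \<and> Q s t" using st v' mn s
      by (intro exI[of _ "(v', max n q)"]) (auto simp: P_def Q_def vm v'_def)
  qed
  then obtain f where f: "\<And>k. P k (f k)" "\<And>k. Q (f k) (f (Suc k))" by blast
  obtain v where v: "\<And>j. agree (snd (f j)) (fst (f j)) v"
    using agree_limit[of "\<lambda>j. snd (f j)" "\<lambda>j. fst (f j)"] f(2) unfolding Q_def by metis
  have ge: "j \<le> snd (f j)" for j
  proof (induction j)
    case (Suc j)
    then show ?case using f(2)[of j] by (simp add: Q_def)
  qed simp
  show thesis
  proof
    show "v \<in> G" by (rule settled_limit(1)[of "\<lambda>_. 0" "\<lambda>j. snd (f j)" "\<lambda>j. fst (f j)"]) (use f(1) v in \<open>auto simp: P_def\<close>)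
    show "agree l x v" using f(1)[of 0] v[of 0] unfolding P_def by (meson agree_mono agree_trans)
    show "\<not> E2 x v"
    proof (rule not_E2_if_cofinal_jumps[of 1])
      fix n
      have "1 \<le> pdelta (snd (f n)) (snd (f (Suc n))) x (fst (f (Suc n)))"
        using f(2)[of n] by (simp add: Q_def)
      also have "\<dots> = pdelta (snd (f n)) (snd (f (Suc n))) x v"
        by (rule pdelta_agree) (simp_all add: v)
      finally show "\<exists>m N. n \<le> m \<and> 1 \<le> pdelta m N x v" using ge by blast
    qed simp
  qed
qed

text \<open>Otherwise one can flip bits \<open>p\<^sub>0 < p\<^sub>1 < \<dots>\<close> with summable weights so that each flip moves the
  image by more than \<open>1\<close>; by the triangle inequality one may decide at each stage whether to flip so
  that the image differs from that of the unflipped point by \<open>1/2\<close>, giving \<open>E\<^sub>2\<close>-equivalent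
  points with inequivalent images.\<close>

lemma single_flips_move_little:
  obtains x0 l0 n0 where "x0 \<in> G"
    "\<And>w w' p N. w \<in> G \<Longrightarrow> w' \<in> G \<Longrightarrow> l0 \<le> p \<Longrightarrow> agree l0 x0 w \<Longrightarrow> (\<And>i. i \<noteq> p \<Longrightarrow> w i = w' i) \<Longrightarrow>
       pdelta n0 N (\<Phi> w) (\<Phi> w') \<le> 1"
proof (rule ccontr)
  note concl = that
  assume "\<not> thesis"
  have neg: "\<exists>w w' p N. w \<in> G \<and> w' \<in> G \<and> l0 \<le> p \<and> agree l0 x0 w \<and> (\<forall>i. i \<noteq> p \<longrightarrow> w i = w' i) \<and>
     1 < pdelta n0 N (\<Phi> w) (\<Phi> w')" if "x0 \<in> G" for x0 l0 n0
  proof (rule ccontr)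
    assume no: "\<not> ?thesis"
    have "pdelta n0 N (\<Phi> w) (\<Phi> w') \<le> 1"
      if "w \<in> G" "w' \<in> G" "l0 \<le> p" "agree l0 x0 w" "\<And>i. i \<noteq> p \<Longrightarrow> w i = w' i" for w w' p N
    proof (rule ccontr)
      assume "\<not> ?thesis"
      then have "1 < pdelta n0 N (\<Phi> w) (\<Phi> w')" by simp
      then show False using no that by blast
    qed
    then show False using concl[OF \<open>x0 \<in> G\<close>] \<open>\<not> thesis\<close> by blast
  qed
  define P where "P k s \<longleftrightarrow> (case s of (x, y, l, N) \<Rightarrow> x \<in> G \<and> y \<in> G \<and> (\<forall>i\<ge>l. x i = y i) \<and>
      settled k N l x \<and> settled k N l y)"
    for k :: nat and s :: "(nat \<Rightarrow> bool) \<times> (nat \<Rightarrow> bool) \<times> nat \<times> nat"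
  \<comment> \<open>The weights \<open>(1/2)^k\<close> in the domain are summable, while each image
    gap starts at index \<open>k\<close> and so yields cofinal jumps.\<close>
  define Q where "Q k s t \<longleftrightarrow> (case s of (x, y, l, N) \<Rightarrow> case t of (x', y', l', N') \<Rightarrow>
      agree l x x' \<and> agree l y y' \<and> l < l' \<and> pdelta l l' x' y' \<le> (1/2)^k \<and>
      1/2 \<le> pdelta k N' (\<Phi> x') (\<Phi> y'))"
    for k :: nat and s t :: "(nat \<Rightarrow> bool) \<times> (nat \<Rightarrow> bool) \<times> nat \<times> nat"
  have "\<exists>f. \<forall>k. P k (f k) \<and> Q k (f k) (f (Suc k))"
  proof (rule dependent_nat_choice)
    obtain x where x: "x \<in> G" using G_nonempty .
    then obtain l where "settled 0 0 l x" using settled_exists by blast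
    then show "\<exists>s. P 0 s" using x by (intro exI[of _ "(x, x, l, 0)"]) (simp add: P_def)
  next
    fix s k assume s: "P k s"
    obtain x y l N0 where sxy: "s = (x, y, l, N0)" by (metis prod_cases4)
    have xy: "x \<in> G" "y \<in> G" "\<And>i. l \<le> i \<Longrightarrow> x i = y i" using s by (auto simp: P_def sxy)
    \<comment> \<open>Since \<open>p\<close> is at least \<open>2 ^ k\<close>, the flipped bit has
      weight at most \<open>(1/2)^k\<close>.\<close>
    define L where "L = max l (2 ^ k)"
    obtain w w' p N where w: "w \<in> G" "w' \<in> G" "L \<le> p" "agree L y w" "\<And>i. i \<noteq> p \<Longrightarrow> w i = w' i"
      "1 < pdelta k N (\<Phi> w) (\<Phi> w')"
      using neg[OF xy(2), of L k] by blast
    have Lp: "l \<le> p" "2 ^ k \<le> p" using w(3) by (auto simp: L_def)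
    \<comment> \<open>Below \<open>l\<close> the point keeps \<open>x\<close>, afterwards it follows
      \<open>w\<close>. The images of \<open>w\<close> and \<open>w'\<close> are more than
      \<open>1\<close> apart, so at least one of them is \<open>1/2\<close> away from that of
      \<open>x'\<close>.\<close>
    define x' where "x' = graft l x w"
    have x': "x' \<in> G" using graft_in_G w(1) by (simp add: x'_def)
    have "1 < pdelta k N (\<Phi> x') (\<Phi> w) + pdelta k N (\<Phi> x') (\<Phi> w')"
      using w(6) pdelta_triangle[of k N "\<Phi> w" "\<Phi> w'" "\<Phi> x'"] pdelta_sym[of k N "\<Phi> w" "\<Phi> x'"] by linarith
    then have "1/2 \<le> pdelta k N (\<Phi> x') (\<Phi> w) \<or> 1/2 \<le> pdelta k N (\<Phi> x') (\<Phi> w')"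
      by linarith
    then obtain y' where y': "y' = w \<or> y' = w'" "1/2 \<le> pdelta k N (\<Phi> x') (\<Phi> y')"
      by blast
    have y'G: "y' \<in> G" using y'(1) w by blast
    have wy': "w i = y' i" if "i \<noteq> p" for i using y'(1) w(5) that by blast
    obtain l1 l2 where "settled (Suc k) N l1 x'" "settled (Suc k) N l2 y'"
      using settled_exists x' y'G by meson
    then obtain l' where l': "settled (Suc k) N l' x'" "settled (Suc k) N l' y'" "Suc p \<le> l'"
      using settled_mono by (metis max.cobounded1 max.cobounded2 order_trans)
    have "agree l y y'"
      using w(4) wy' Lp by (auto simp: agree_def L_def)
    moreover have "pdelta l l' x' y' \<le> (1/2)^k"
    proof -
      have "pdelta l l' x' y' = pdelta l l' w y'"
        unfolding pdelta_def by (rule sum.cong) (auto simp: x'_def graft_def)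
      also have "\<dots> \<le> 1 / (real p + 1)" by (rule pdelta_single) (rule wy')
      also have "\<dots> \<le> 1 / 2 ^ k"
      proof (rule divide_left_mono)
        have "real (2 ^ k) \<le> real p" using Lp(2) by (rule of_nat_mono)
        then show "2 ^ k \<le> real p + 1" unfolding of_nat_power of_nat_numeral by linarith
      qed auto
      finally show ?thesis by (simp add: power_one_over)
    qed
    moreover have "x' i = y' i" if "l' \<le> i" for i
      using that l'(3) Lp wy'[of i] by (simp add: x'_def graft_def)
    ultimately show "\<exists>t. P (Suc k) t \<and> Q k s t" using l' x' y'G y'(2) Lp
      by (intro exI[of _ "(x', y', l', N)"]) (auto simp: P_def Q_def sxy x'_def)
  qed
  then obtain f where f: "\<And>k. P k (f k)" "\<And>k. Q k (f k) (f (Suc k))" by blast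
  define X Y l N where "X j = fst (f j)" and "Y j = fst (snd (f j))" and "l j = fst (snd (snd (f j)))"
    and "N j = snd (snd (snd (f j)))" for j
  have fj: "f j = (X j, Y j, l j, N j)" for j by (simp add: X_def Y_def l_def N_def)
  have PX: "settled j (N j) (l j) (X j)" "settled j (N j) (l j) (Y j)" for j
    using f(1)[of j] by (auto simp: P_def fj)
  have QX: "agree (l j) (X j) (X (Suc j))" "agree (l j) (Y j) (Y (Suc j))" "l j < l (Suc j)"
    "pdelta (l j) (l (Suc j)) (X (Suc j)) (Y (Suc j)) \<le> (1/2)^j"
    "1/2 \<le> pdelta j (N (Suc j)) (\<Phi> (X (Suc j))) (\<Phi> (Y (Suc j)))" for j
    using f(2)[of j] by (auto simp: Q_def fj)
  obtain x where x: "\<And>j. agree (l j) (X j) x" using agree_limit[of l X, OF QX(1,3)] by blast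
  obtain y where y: "\<And>j. agree (l j) (Y j) y" using agree_limit[of l Y, OF QX(2,3)] by blast
  have "pdelta 0 (l k) x y \<le> pdelta 0 (l 0) x y + 2 - 2 * (1/2)^k" for k
  proof (induction k)
    case (Suc k)
    have "pdelta (l k) (l (Suc k)) x y \<le> (1/2)^k"
      using QX(4)[of k] pdelta_agree[OF x[of "Suc k"] y[of "Suc k"], of "l k"] by simp
    then show ?case using Suc pdelta_split[of 0 "l k" "l (Suc k)" x y] QX(3)[of k] by simp
  qed simp
  then have bd: "pdelta 0 (l k) x y \<le> pdelta 0 (l 0) x y + 2" for k
    by (smt (verit) zero_le_power divide_nonneg_pos)
  have ge: "j \<le> l j" for j
  proof (induction j)
    case (Suc j)
    then show ?case using QX(3)[of j] by simp
  qed simp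
  have "E2 x y" unfolding E2_iff_bounded
    using bd pdelta_mono[OF le_refl ge] order_trans by blast
  then have "E2 (\<Phi> x) (\<Phi> y)" using reduction by blast
  moreover have "\<not> E2 (\<Phi> x) (\<Phi> y)"
  proof (rule not_E2_if_cofinal_jumps[of "1/2"])
    fix j
    have "agree (N (Suc j)) (\<Phi> (X (Suc j))) (\<Phi> x)" "agree (N (Suc j)) (\<Phi> (Y (Suc j))) (\<Phi> y)"
      using settled_limit(2)[of N l X, OF PX(1) x] settled_limit(2)[of N l Y, OF PX(2) y] by blast+
    then have "1/2 \<le> pdelta j (N (Suc j)) (\<Phi> x) (\<Phi> y)" using QX(5)[of j] pdelta_agree by metis
    then show "\<exists>m N. j \<le> m \<and> 1/2 \<le> pdelta m N (\<Phi> x) (\<Phi> y)" by blast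
  qed simp
  ultimately show False by blast
qed

end

section \<open>Triples in the range of a reduction\<close>

context tame_reduction
begin

context
  fixes x0 :: "nat \<Rightarrow> bool" and l0 n0 :: nat
  assumes x0_in_G: "x0 \<in> G"
    and flip: "\<And>w w' p N. w \<in> G \<Longrightarrow> w' \<in> G \<Longrightarrow> l0 \<le> p \<Longrightarrow> agree l0 x0 w \<Longrightarrow>
      (\<And>i. i \<noteq> p \<Longrightarrow> w i = w' i) \<Longrightarrow> pdelta n0 N (\<Phi> w) (\<Phi> w') \<le> 1"
begin

text \<open>The invariant of the fusion. The clause over all \<open>w\<close> in \<open>G\<close>
  keeps the images of \<open>y\<close> and \<open>z\<close> close for every common continuation,
  which later allows both to be moved together. The last line confines the image distance to a
  window of width \<open>1\<close>.\<close>

definition stage :: "nat \<Rightarrow> (nat \<Rightarrow> bool) \<Rightarrow> (nat \<Rightarrow> bool) \<Rightarrow> (nat \<Rightarrow> bool) \<Rightarrow> nat \<Rightarrow> nat \<Rightarrow> bool" where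
  "stage j x y z l n \<longleftrightarrow> x \<in> G \<and> y \<in> G \<and> z \<in> G \<and> l0 \<le> l \<and> n0 \<le> n \<and>
    agree l0 x0 x \<and> agree l0 x0 y \<and> (\<forall>i\<ge>l. x i = y i \<and> x i = z i) \<and>
    settled j n l x \<and> settled j n l y \<and> settled j n l z \<and>
    (\<forall>N. pdelta n N (\<Phi> x) (\<Phi> y) \<le> 1) \<and> (\<forall>N. pdelta n N (\<Phi> x) (\<Phi> z) \<le> 1) \<and>
    (\<forall>w\<in>G. \<forall>N. pdelta n N (\<Phi> (graft l y w)) (\<Phi> (graft l z w)) \<le> 1) \<and>
    100 * real j \<le> pdelta 0 n (\<Phi> x) (\<Phi> y) \<and> pdelta 0 n (\<Phi> x) (\<Phi> y) \<le> 100 * real j + 1"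

lemma stage_0: "\<exists>l. stage 0 x0 x0 x0 l n0"
proof -
  obtain l where "settled 0 n0 l x0" using settled_exists[OF x0_in_G] by blast
  then have "settled 0 n0 (max l0 l) x0" using settled_mono by simp
  then show ?thesis using x0_in_G by (intro exI[of _ "max l0 l"]) (simp add: stage_def)
qed

text \<open>Move \<open>y\<close> bit by bit towards a point inequivalent to \<open>x\<close>. The distance of the images from
  \<open>\<Phi> x\<close> changes by at most \<open>1\<close> in each step and becomes unbounded, so it hits the window
  \<open>[100 (j + 1), 100 (j + 1) + 1]\<close>. Leaving \<open>z\<close> alone keeps its image close to that of \<open>x\<close>,
  and moving it together with \<open>y\<close> keeps it close to that of \<open>y\<close>.\<close>

lemma stage_Suc:
  assumes st: "stage j x y z l n"
  shows "\<exists>y' z' l' n'. stage (Suc j) x y' z' l' n' \<and> l < l' \<and> n \<le> n' \<and> agree l y y' \<and> agree l z z' \<and>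
    (if c then pdelta n n' (\<Phi> y') (\<Phi> z') \<le> 1 else pdelta n n' (\<Phi> x) (\<Phi> z') \<le> 1)"
proof -
  have G: "x \<in> G" "y \<in> G" "z \<in> G" and l0: "l0 \<le> l" "agree l0 x0 x" "agree l0 x0 y" and n0: "n0 \<le> n"
    and eq: "\<And>i. l \<le> i \<Longrightarrow> x i = y i" "\<And>i. l \<le> i \<Longrightarrow> x i = z i"
    and sett: "settled j n l x" "settled j n l y" "settled j n l z"
    and xy: "\<And>N. pdelta n N (\<Phi> x) (\<Phi> y) \<le> 1" and xz: "\<And>N. pdelta n N (\<Phi> x) (\<Phi> z) \<le> 1"
    and yz: "\<And>w N. w \<in> G \<Longrightarrow> pdelta n N (\<Phi> (graft l y w)) (\<Phi> (graft l z w)) \<le> 1"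
    and le: "pdelta 0 n (\<Phi> x) (\<Phi> y) \<le> 100 * real j + 1"
    using st unfolding stage_def by auto
  define R where "R = 100 * real (Suc j)"
  obtain v where v: "v \<in> G" "agree l x v" "\<not> E2 x v" using E2_inequivalent_neighbour[OF G(1)] .
  \<comment> \<open>\<open>Y i\<close> interpolates: it equals \<open>y\<close> at
    \<open>i = l\<close>, changes at most one bit when \<open>i\<close> grows by one, and tends to a
    point with the tail of \<open>v\<close>. That limit is inequivalent to \<open>x\<close>, so by
    continuity some \<open>Y i\<close> is already \<open>far\<close>.\<close>
  define Y where "Y i = graft l y (graft i v x)" for i
  have YG: "Y i \<in> G" for i unfolding Y_def by (intro graft_in_G G)
  have Yy: "agree l y (Y i)" for i by (simp add: Y_def)
  define far where "far i \<longleftrightarrow> (\<exists>N. R \<le> pdelta 0 N (\<Phi> x) (\<Phi> (Y i)))" for i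
  have "graft l v x = x" using v(2) by (auto simp: agree_def graft_def)
  then have Yl: "Y l = y" unfolding Y_def using eq(1) by (auto simp: graft_def)
  have near_l: "\<not> far l"
  proof
    assume "far l"
    then obtain N where "R \<le> pdelta 0 N (\<Phi> x) (\<Phi> y)" unfolding far_def Yl by blast
    then show False
      using pdelta_le_add_tail[of N "\<Phi> x" "\<Phi> y" n] xy[of N] le by (simp add: R_def)
  qed
  have "\<exists>i\<ge>l. far i"
  proof -
    define Z where "Z = graft l y v"
    have ZG: "Z \<in> G" unfolding Z_def by (intro graft_in_G v)
    have "E2 Z v" by (rule E2_eventually_equal[of l]) (simp add: Z_def graft_def)
    then have "\<not> E2 (\<Phi> x) (\<Phi> Z)" using v(3) E2_trans reduction by blast
    then obtain N where N: "R \<le> pdelta 0 N (\<Phi> x) (\<Phi> Z)"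
      unfolding E2_iff_bounded by (meson linear)
    obtain q where q: "settled 0 N q Z" using settled_exists[OF ZG] by blast
    have "agree q Z (Y (max q l))" by (auto simp: agree_def Z_def Y_def graft_def)
    then have "agree N (\<Phi> Z) (\<Phi> (Y (max q l)))" using settledD[OF q YG] by blast
    then have "R \<le> pdelta 0 N (\<Phi> x) (\<Phi> (Y (max q l)))" using N pdelta_agree[OF agree_refl] by metis
    then show ?thesis unfolding far_def by (intro exI[of _ "max q l"]) auto
  qed
  then obtain m where m: "l \<le> m" "far m" "\<And>i. l \<le> i \<Longrightarrow> far i \<Longrightarrow> m \<le> i"
    using LeastI_ex[of "\<lambda>i. l \<le> i \<and> far i"] Least_le[of "\<lambda>i. l \<le> i \<and> far i"] by blast
  have "m \<noteq> l" using near_l m(2) by blast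
  then obtain i where i: "m = Suc i" "l \<le> i" using m(1) by (cases m) auto
  have near_i: "pdelta 0 N (\<Phi> x) (\<Phi> (Y i)) < R" for N
    using m(3)[OF i(2)] i(1) unfolding far_def by (meson Suc_n_not_le_n not_le)
  have upper: "pdelta 0 N (\<Phi> x) (\<Phi> (Y m)) \<le> R + 1" for N
  proof -
    have "pdelta n0 N (\<Phi> (Y i)) (\<Phi> (Y m)) \<le> 1"
    proof (rule flip[OF YG YG, of i])
      show "l0 \<le> i" using i l0 by simp
      show "agree l0 x0 (Y i)" using Yy l0 agree_mono agree_trans by blast
      show "Y i k = Y m k" if "k \<noteq> i" for k
        using that by (auto simp: Y_def graft_def i(1))
    qed
    then have "pdelta n N (\<Phi> (Y i)) (\<Phi> (Y m)) \<le> 1"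
      using pdelta_mono[OF n0 le_refl] order_trans by blast
    moreover have "agree n (\<Phi> (Y i)) (\<Phi> (Y m))"
      using settledD[OF sett(2) YG Yy] agree_sym agree_trans by blast
    then have "pdelta 0 n (\<Phi> (Y i)) (\<Phi> (Y m)) = 0" by (simp add: pdelta_def agree_def)
    ultimately have "pdelta 0 N (\<Phi> (Y i)) (\<Phi> (Y m)) \<le> 1"
      using pdelta_le_add_tail[of N "\<Phi> (Y i)" "\<Phi> (Y m)" n] by simp
    then show ?thesis
      using near_i[of N] pdelta_triangle[of 0 N "\<Phi> x" "\<Phi> (Y m)" "\<Phi> (Y i)"] by linarith
  qed
  obtain N1 where N1: "R \<le> pdelta 0 N1 (\<Phi> x) (\<Phi> (Y m))" using m(2) unfolding far_def by blast
  \<comment> \<open>\<open>Y m\<close> and, if \<open>c\<close> holds, \<open>z'\<close> graft the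
    old prefixes onto the same \<open>w\<close>, so the uniform clause of \<open>stage\<close>
    applies to this pair.\<close>
  define w where "w = graft m v x"
  have wG: "w \<in> G" unfolding w_def by (intro graft_in_G G)
  have Ym: "Y m = graft l y w" by (simp add: Y_def w_def)
  define z' where "z' = (if c then graft l z w else z)"
  have z'G: "z' \<in> G" using wG G graft_in_G by (simp add: z'_def)
  have tails: "x i = Y m i" "x i = z' i" if "m \<le> i" for i
    using that m(1) eq by (auto simp: Y_def z'_def w_def graft_def)
  then have E2s: "E2 (\<Phi> x) (\<Phi> (Y m))" "E2 (\<Phi> x) (\<Phi> z')"
    using E2_eventually_equal[of m x] reduction by blast+
  then have "E2 (\<Phi> (Y m)) (\<Phi> z')" using E2_sym E2_trans by blast
  \<comment> \<open>Three successive thresholds bound the image tails of all three pairs by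
    \<open>1\<close>; starting beyond \<open>N1\<close> keeps the lower bound \<open>R\<close> valid
    at \<open>n'\<close>.\<close>
  obtain n1 where n1: "max n N1 \<le> n1" "\<And>N. pdelta n1 N (\<Phi> x) (\<Phi> (Y m)) \<le> 1"
    using E2_tail_small[OF E2s(1), of 1 "max n N1"] by auto
  obtain n2 where n2: "n1 \<le> n2" "\<And>N. pdelta n2 N (\<Phi> x) (\<Phi> z') \<le> 1"
    using E2_tail_small[OF E2s(2), of 1 n1] by auto
  obtain n' where n': "n2 \<le> n'" "\<And>N. pdelta n' N (\<Phi> (Y m)) (\<Phi> z') \<le> 1"
    using E2_tail_small[OF \<open>E2 (\<Phi> (Y m)) (\<Phi> z')\<close>, of 1 n2] by auto
  have nn: "n1 \<le> n'" "n \<le> n'" "N1 \<le> n'" using n1 n2 n' by auto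
  have t1: "pdelta n' N (\<Phi> x) (\<Phi> (Y m)) \<le> 1" for N
    using n1(2)[of N] pdelta_mono[OF nn(1) le_refl] order_trans by blast
  have t2: "pdelta n' N (\<Phi> x) (\<Phi> z') \<le> 1" for N
    using n2(2)[of N] pdelta_mono[OF n'(1) le_refl] order_trans by blast
  \<comment> \<open>Here \<open>stable\<close> turns the bound for the single pair
    \<open>Y m\<close>, \<open>z'\<close> into one for all points of \<open>G\<close> near
    \<open>Y m\<close>; taking \<open>l'\<close> at least \<open>k\<close> restores the uniform
    clause.\<close>
  have "\<exists>k. \<forall>w\<in>G. agree k (Y m) w \<longrightarrow> (\<forall>N. pdelta n' N (\<Phi> w) (\<Phi> (graft m z' w)) \<le> 1)"
    by (rule stable[OF YG z'G _ n'(2)]) (metis tails)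
  then obtain k where k: "\<And>w N. w \<in> G \<Longrightarrow> agree k (Y m) w \<Longrightarrow> pdelta n' N (\<Phi> w) (\<Phi> (graft m z' w)) \<le> 1"
    by blast
  obtain a1 a2 a3 where a: "settled (Suc j) n' a1 x" "settled (Suc j) n' a2 (Y m)" "settled (Suc j) n' a3 z'"
    using settled_exists G(1) YG z'G by meson
  define l' where "l' = max (max m k) (max a1 (max a2 a3))"
  have l': "m \<le> l'" "k \<le> l'" "a1 \<le> l'" "a2 \<le> l'" "a3 \<le> l'" by (auto simp: l'_def)
  have "stage (Suc j) x (Y m) z' l' n'"
    unfolding stage_def
  proof (intro conjI allI impI ballI)
    show "x \<in> G" "Y m \<in> G" "z' \<in> G" by (rule G YG z'G)+
    show "l0 \<le> l'" using l0(1) m(1) l'(1) by linarith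
    show "n0 \<le> n'" using n0 nn by linarith
    show "agree l0 x0 x" by (rule l0)
    show "agree l0 x0 (Y m)" using Yy l0 agree_mono agree_trans by blast
    show "x i = Y m i" "x i = z' i" if "l' \<le> i" for i using tails that l'(1) by auto
    show "settled (Suc j) n' l' x" "settled (Suc j) n' l' (Y m)" "settled (Suc j) n' l' z'"
      using a l' settled_mono by blast+
    show "pdelta n' N (\<Phi> x) (\<Phi> (Y m)) \<le> 1" "pdelta n' N (\<Phi> x) (\<Phi> z') \<le> 1" for N by (rule t1 t2)+
    show "pdelta n' N (\<Phi> (graft l' (Y m) u)) (\<Phi> (graft l' z' u)) \<le> 1" if "u \<in> G" for u N
    proof -
      have "graft m z' (graft l' (Y m) u) = graft l' z' u"
      proof
        fix i
        show "graft m z' (graft l' (Y m) u) i = graft l' z' u i"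
          using tails[of i] l'(1) by (auto simp: graft_def)
      qed
      then show ?thesis using k[OF graft_in_G[OF that], of l' "Y m" N] l'(2) by simp
    qed
    show "100 * real (Suc j) \<le> pdelta 0 n' (\<Phi> x) (\<Phi> (Y m))"
      using N1 pdelta_mono[OF le_refl nn(3), of 0 "\<Phi> x" "\<Phi> (Y m)"] by (simp add: R_def)
    show "pdelta 0 n' (\<Phi> x) (\<Phi> (Y m)) \<le> 100 * real (Suc j) + 1"
      using upper[of n'] by (simp add: R_def)
  qed
  moreover have "l < l'" using i l'(1) by simp
  moreover have "agree l z z'" by (simp add: z'_def)
  moreover have "if c then pdelta n n' (\<Phi> (Y m)) (\<Phi> z') \<le> 1 else pdelta n n' (\<Phi> x) (\<Phi> z') \<le> 1"
    using yz[OF wG, of n'] xz[of n'] by (simp add: z'_def Ym)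
  ultimately show ?thesis using nn(2) Yy by blast
qed

text \<open>Stage \<open>j\<close> fixes the first \<open>n j\<close> image bits, so distance bounds
  up to \<open>n j\<close> pass to the limits. The sequence \<open>c\<close> prescribes for each
  block which of the two images the third one follows.\<close>

lemma controlled_triple_aux:
  fixes c :: "nat \<Rightarrow> bool"
  obtains X Y Z n where "X \<in> range \<Phi>" "Y \<in> range \<Phi>" "Z \<in> range \<Phi>"
    "\<And>j. n j \<le> n (Suc j)" "pdelta 0 (n 0) X Z = 0"
    "\<And>j. 100 * real j \<le> pdelta 0 (n j) X Y" "\<And>j. pdelta 0 (n j) X Y \<le> 100 * real j + 1"
    "\<And>j. c j \<Longrightarrow> pdelta (n j) (n (Suc j)) Y Z \<le> 1"
    "\<And>j. \<not> c j \<Longrightarrow> pdelta (n j) (n (Suc j)) X Z \<le> 1"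
proof -
  obtain l where l: "stage 0 x0 x0 x0 l n0" using stage_0 by blast
  \<comment> \<open>Requiring \<open>z = x0\<close> at stage \<open>0\<close> yields the zero
    initial distance of \<open>X\<close> and \<open>Z\<close>.\<close>
  define P where "P j s \<longleftrightarrow> (case s of (y, z, l, n) \<Rightarrow> stage j x0 y z l n \<and> (j = 0 \<longrightarrow> z = x0))"
    for j :: nat and s :: "(nat \<Rightarrow> bool) \<times> (nat \<Rightarrow> bool) \<times> nat \<times> nat"
  define Q where "Q j s t \<longleftrightarrow> (case s of (y, z, l, n) \<Rightarrow> case t of (y', z', l', n') \<Rightarrow>
      l < l' \<and> n \<le> n' \<and> agree l y y' \<and> agree l z z' \<and>
      (if c j then pdelta n n' (\<Phi> y') (\<Phi> z') \<le> 1 else pdelta n n' (\<Phi> x0) (\<Phi> z') \<le> 1))"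
    for j :: nat and s t :: "(nat \<Rightarrow> bool) \<times> (nat \<Rightarrow> bool) \<times> nat \<times> nat"
  have "\<exists>f. \<forall>j. P j (f j) \<and> Q j (f j) (f (Suc j))"
  proof (rule dependent_nat_choice)
    show "\<exists>s. P 0 s" using l by (intro exI[of _ "(x0, x0, l, n0)"]) (simp add: P_def)
  next
    fix s j assume s: "P j s"
    obtain y z l n where syz: "s = (y, z, l, n)" by (metis prod_cases4)
    have "stage j x0 y z l n" using s by (simp add: P_def syz)
    from stage_Suc[OF this, of "c j"] obtain y' z' l' n' where "stage (Suc j) x0 y' z' l' n'" "l < l'" "n \<le> n'"
      "agree l y y'" "agree l z z'"
      "if c j then pdelta n n' (\<Phi> y') (\<Phi> z') \<le> 1 else pdelta n n' (\<Phi> x0) (\<Phi> z') \<le> 1"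
      by blast
    then show "\<exists>t. P (Suc j) t \<and> Q j s t"
      by (intro exI[of _ "(y', z', l', n')"]) (simp add: P_def Q_def syz)
  qed
  then obtain f where f: "\<And>j. P j (f j)" "\<And>j. Q j (f j) (f (Suc j))" by blast
  define Y Z l n where "Y j = fst (f j)" and "Z j = fst (snd (f j))" and "l j = fst (snd (snd (f j)))"
    and "n j = snd (snd (snd (f j)))" for j
  have fj: "f j = (Y j, Z j, l j, n j)" for j by (simp add: Y_def Z_def l_def n_def)
  have P: "stage j x0 (Y j) (Z j) (l j) (n j)" "Z 0 = x0" for j
    using f(1)[of j] f(1)[of 0] by (auto simp: P_def fj)
  have Q: "l j < l (Suc j)" "n j \<le> n (Suc j)" "agree (l j) (Y j) (Y (Suc j))" "agree (l j) (Z j) (Z (Suc j))"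
    "c j \<Longrightarrow> pdelta (n j) (n (Suc j)) (\<Phi> (Y (Suc j))) (\<Phi> (Z (Suc j))) \<le> 1"
    "\<not> c j \<Longrightarrow> pdelta (n j) (n (Suc j)) (\<Phi> x0) (\<Phi> (Z (Suc j))) \<le> 1" for j
    using f(2)[of j] by (auto simp: Q_def fj)
  obtain y where y: "\<And>j. agree (l j) (Y j) y" using agree_limit[of l Y, OF Q(3,1)] by blast
  obtain z where z: "\<And>j. agree (l j) (Z j) z" using agree_limit[of l Z, OF Q(4,1)] by blast
  have "settled j (n j) (l j) (Y j)" "settled j (n j) (l j) (Z j)" for j
    using P(1)[of j] unfolding stage_def by blast+
  then have ay: "agree (n j) (\<Phi> (Y j)) (\<Phi> y)" and az: "agree (n j) (\<Phi> (Z j)) (\<Phi> z)" for j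
    using settled_limit(2)[of n l Y y j] settled_limit(2)[of n l Z z j] y z by blast+
  show thesis
  proof (rule that[of "\<Phi> x0" "\<Phi> y" "\<Phi> z" n])
    show "n j \<le> n (Suc j)" for j by (rule Q)
    show "pdelta 0 (n 0) (\<Phi> x0) (\<Phi> z) = 0" using pdelta_agree[OF agree_refl az[of 0]] P(2) by (metis pdelta_self)
    have "pdelta 0 (n j) (\<Phi> x0) (\<Phi> (Y j)) = pdelta 0 (n j) (\<Phi> x0) (\<Phi> y)" for j
      by (rule pdelta_agree[OF agree_refl ay])
    moreover have "100 * real j \<le> pdelta 0 (n j) (\<Phi> x0) (\<Phi> (Y j))"
      "pdelta 0 (n j) (\<Phi> x0) (\<Phi> (Y j)) \<le> 100 * real j + 1" for j
      using P(1)[of j] unfolding stage_def by blast+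
    ultimately show "100 * real j \<le> pdelta 0 (n j) (\<Phi> x0) (\<Phi> y)"
      "pdelta 0 (n j) (\<Phi> x0) (\<Phi> y) \<le> 100 * real j + 1" for j by metis+
    show "pdelta (n j) (n (Suc j)) (\<Phi> y) (\<Phi> z) \<le> 1" if "c j" for j
      using Q(5)[OF that] pdelta_agree[OF ay[of "Suc j"] az[of "Suc j"], of "n j"] by metis
    show "pdelta (n j) (n (Suc j)) (\<Phi> x0) (\<Phi> z) \<le> 1" if "\<not> c j" for j
      using Q(6)[OF that] pdelta_agree[OF agree_refl[of "n (Suc j)" "\<Phi> x0"] az[of "Suc j"], of "n j"] by metis
  qed auto
qed

end

lemma controlled_triple:
  fixes c :: "nat \<Rightarrow> bool"
  obtains X Y Z n where "X \<in> range \<Phi>" "Y \<in> range \<Phi>" "Z \<in> range \<Phi>"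
    "\<And>j. n j \<le> n (Suc j)" "pdelta 0 (n 0) X Z = 0"
    "\<And>j. 100 * real j \<le> pdelta 0 (n j) X Y" "\<And>j. pdelta 0 (n j) X Y \<le> 100 * real j + 1"
    "\<And>j. c j \<Longrightarrow> pdelta (n j) (n (Suc j)) Y Z \<le> 1"
    "\<And>j. \<not> c j \<Longrightarrow> pdelta (n j) (n (Suc j)) X Z \<le> 1"
proof -
  obtain x0 l0 n0 where *: "x0 \<in> G"
    "\<And>w w' p N. w \<in> G \<Longrightarrow> w' \<in> G \<Longrightarrow> l0 \<le> p \<Longrightarrow> agree l0 x0 w \<Longrightarrow> (\<And>i. i \<noteq> p \<Longrightarrow> w i = w' i) \<Longrightarrow>
       pdelta n0 N (\<Phi> w) (\<Phi> w') \<le> 1"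
    using single_flips_move_little by metis
  show thesis
    by (rule controlled_triple_aux[where c = c and ?x0.0 = x0 and ?l0.0 = l0 and ?n0.0 = n0]) (fact * that)+
qed

end

section \<open>Decoding\<close>

text \<open>The thresholds of the construction depend on the reduction and are unknown to the
  decoder. First passage times depend on \<open>x\<close> and \<open>y\<close> alone and stand in
  for them.\<close>

definition first_reach :: "(nat \<Rightarrow> bool) \<Rightarrow> (nat \<Rightarrow> bool) \<Rightarrow> real \<Rightarrow> nat \<Rightarrow> bool" where
  "first_reach x y r n \<longleftrightarrow> r \<le> pdelta 0 n x y \<and> (\<forall>k<n. pdelta 0 k x y < r)"

lemma first_reach_unique: "first_reach x y r m \<Longrightarrow> first_reach x y r n \<Longrightarrow> m = n"
  unfolding first_reach_def by (metis linorder_neqE_nat not_le)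

lemma first_reach_agree:
  "agree n x x' \<Longrightarrow> agree n y y' \<Longrightarrow> first_reach x y r n \<Longrightarrow> first_reach x' y' r n"
  unfolding first_reach_def
  by (metis agree_mono less_imp_le order_refl pdelta_agree)

lemma first_reach_exists:
  assumes "r \<le> pdelta 0 n x y"
  obtains m where "m \<le> n" "first_reach x y r m"
proof
  let ?m = "LEAST m. r \<le> pdelta 0 m x y"
  show "?m \<le> n" by (rule Least_le) (rule assms)
  show "first_reach x y r ?m"
    unfolding first_reach_def using LeastI[of "\<lambda>m. r \<le> pdelta 0 m x y", OF assms]
      not_less_Least[of _ "\<lambda>m. r \<le> pdelta 0 m x y"]
    by (auto simp: not_le)
qed

text \<open>Only every third block between the times at which the partial distance of \<open>x\<close> and \<open>y\<close> passes
  a multiple of \<open>100\<close> carries a bit; the others leave room to make \<open>z\<close> inequivalent to both.\<close>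

definition decode :: "(nat \<Rightarrow> bool) \<times> (nat \<Rightarrow> bool) \<times> (nat \<Rightarrow> bool) \<Rightarrow> (nat \<Rightarrow> bool)" where
  "decode = (\<lambda>(x, y, z) i. \<exists>m n. first_reach x y (100 * real (3 * i)) m \<and>
     first_reach x y (100 * real (Suc (3 * i))) n \<and> 50 \<le> pdelta m n x z)"

text \<open>With \<open>j = 3 * i\<close>, the passage time of \<open>100 j\<close> is at most
  \<open>n j\<close>, with \<open>X\<close> and \<open>Y\<close> at distance at most
  \<open>1\<close> in between, and that of \<open>100 (j + 1)\<close> lies between
  \<open>n j\<close> and \<open>n (Suc j)\<close>. On the decoded block \<open>X\<close> and
  \<open>Z\<close> are at least \<open>98\<close> apart if \<open>c j\<close> holds and at most
  \<open>3\<close> apart otherwise.\<close>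

lemma decode_controlled:
  assumes mono: "\<And>j. n j \<le> n (Suc j)" and start: "pdelta 0 (n 0) X Z = 0"
    and lower: "\<And>j. 100 * real j \<le> pdelta 0 (n j) X Y" and upper: "\<And>j. pdelta 0 (n j) X Y \<le> 100 * real j + 1"
    and yz: "\<And>j. c j \<Longrightarrow> pdelta (n j) (n (Suc j)) Y Z \<le> 1"
    and xz: "\<And>j. \<not> c j \<Longrightarrow> pdelta (n j) (n (Suc j)) X Z \<le> 1"
  shows "decode (X, Y, Z) i = c (3 * i)"
proof -
  define j where "j = 3 * i"
  obtain s where s: "s \<le> n j" "first_reach X Y (100 * real j) s" using first_reach_exists[OF lower] .
  obtain t where t: "t \<le> n (Suc j)" "first_reach X Y (100 * real (Suc j)) t" using first_reach_exists[OF lower] .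
  have "n j \<le> t"
  proof (rule ccontr)
    assume "\<not> n j \<le> t"
    then have "pdelta 0 t X Y \<le> pdelta 0 (n j) X Y" by (intro pdelta_mono) auto
    then show False using t(2) upper[of j] by (simp add: first_reach_def)
  qed
  then have st: "pdelta s t X W = pdelta s (n j) X W + pdelta (n j) t X W" for W using s(1) pdelta_split by blast
  \<comment> \<open>Between \<open>s\<close> and \<open>n j\<close> the rule of the previous block
    is in force: \<open>Z\<close> follows \<open>X\<close> or \<open>Y\<close>, which are within
    \<open>1\<close> of each other there. For \<open>j = 0\<close> the assumption
    \<open>start\<close> takes its place.\<close>
  have before: "pdelta s (n j) X Z \<le> 2"
  proof (cases j)
    case 0
    then show ?thesis using pdelta_mono[of 0 s "n j" "n j" X Z] start by simp
  next
    case (Suc k)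
    have "n k \<le> s"
    proof (rule ccontr)
      assume "\<not> n k \<le> s"
      then have "pdelta 0 s X Y \<le> pdelta 0 (n k) X Y" by (intro pdelta_mono) auto
      then show False using s(2) upper[of k] by (simp add: first_reach_def Suc)
    qed
    then have sub: "pdelta s (n j) V W \<le> pdelta (n k) (n (Suc k)) V W" for V W
      by (intro pdelta_mono) (simp_all add: Suc)
    have "pdelta s (n j) X Y \<le> 1"
      using s(2) upper[of j] pdelta_split[of 0 s "n j" X Y] s(1) by (simp add: first_reach_def)
    then show ?thesis
      using yz[of k] xz[of k] sub[of Y Z] sub[of X Z] pdelta_triangle[of s "n j" X Z Y]
      by (cases "c k") auto
  qed
  have sub: "pdelta (n j) t V W \<le> pdelta (n j) (n (Suc j)) V W" for V W
    using t(1) by (intro pdelta_mono) simp_all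
  have "decode (X, Y, Z) i \<longleftrightarrow> 50 \<le> pdelta s t X Z"
    unfolding decode_def prod.case j_def[symmetric] using s(2) t(2) first_reach_unique by blast
  also have "\<dots> \<longleftrightarrow> c j"
  proof (cases "c j")
    case True
    have "99 \<le> pdelta (n j) t X Y"
      using t(2) upper[of j] pdelta_split[of 0 "n j" t X Y] \<open>n j \<le> t\<close> by (simp add: first_reach_def)
    moreover have "pdelta (n j) t Y Z \<le> 1" using yz[OF True] sub[of Y Z] by linarith
    ultimately have "98 \<le> pdelta (n j) t X Z"
      using pdelta_triangle[of "n j" t X Y Z] pdelta_sym[of "n j" t Y Z] by linarith
    then show ?thesis using True st[of Z] pdelta_nonneg[of s "n j" X Z] by simp
  next
    case False
    then show ?thesis using xz[OF False] sub[of X Z] before st[of Z] by simp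
  qed
  finally show ?thesis by (simp add: j_def)
qed

lemma decode_surjective:
  assumes "Delta11_reducible E2 E2 A"
  shows "decode ` E2_triples A = UNIV"
proof -
  obtain \<Phi> where \<Phi>: "Delta11_reduction E2 E2 A \<Phi>" using assms by (auto simp: Delta11_reducible_def)
  then have range: "range \<Phi> \<subseteq> A" by (simp add: Delta11_reduction_def)
  obtain U G where "tame_reduction \<Phi> U G" using tame_reduction_exists[OF \<Phi>] by blast
  then interpret tame_reduction \<Phi> U G .
  have "b \<in> decode ` E2_triples A" for b
  proof -
    \<comment> \<open>Indices \<open>0\<close> modulo \<open>3\<close> carry the bits of
      \<open>b\<close>. The value is true at \<open>1\<close> and false at \<open>2\<close> modulo
      \<open>3\<close>, so \<open>Z\<close> leaves \<open>X\<close> and leaves \<open>Y\<close>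
      infinitely often.\<close>
    define c where "c j = (if j mod 3 = 0 then b (j div 3) else j mod 3 = 1)" for j :: nat
    obtain X Y Z n where XYZ: "X \<in> range \<Phi>" "Y \<in> range \<Phi>" "Z \<in> range \<Phi>"
      and mono: "\<And>j. n j \<le> n (Suc j)" and start: "pdelta 0 (n 0) X Z = 0"
      and lower: "\<And>j. 100 * real j \<le> pdelta 0 (n j) X Y" and upper: "\<And>j. pdelta 0 (n j) X Y \<le> 100 * real j + 1"
      and yz: "\<And>j. c j \<Longrightarrow> pdelta (n j) (n (Suc j)) Y Z \<le> 1"
      and xz: "\<And>j. \<not> c j \<Longrightarrow> pdelta (n j) (n (Suc j)) X Z \<le> 1"
      using controlled_triple[of c] by metis
    have jump: "99 \<le> pdelta (n j) (n (Suc j)) X Y" for j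
      using lower[of "Suc j"] upper[of j] pdelta_split[of 0 "n j" "n (Suc j)" X Y] mono[of j] by simp
    have jump_xz: "98 \<le> pdelta (n j) (n (Suc j)) X Z" if "c j" for j
      using jump[of j] yz[OF that] pdelta_triangle[of "n j" "n (Suc j)" X Y Z]
        pdelta_sym[of "n j" "n (Suc j)" Y Z] by linarith
    have jump_yz: "98 \<le> pdelta (n j) (n (Suc j)) Y Z" if "\<not> c j" for j
      using jump[of j] xz[OF that] pdelta_triangle[of "n j" "n (Suc j)" X Y Z]
        pdelta_sym[of "n j" "n (Suc j)" Y Z] by linarith
    have "n j < n (Suc j)" for j
      using jump[of j] by (intro ccontr[of "n j < n (Suc j)"]) simp
    then have "strict_mono n" by (rule strict_mono_Suc_iff[THEN iffD2, OF allI])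
    then have ge: "j \<le> n j" for j by (rule strict_mono_imp_increasing)
    have "\<not> E2 X Y"
    proof (rule not_E2_if_cofinal_jumps[of 99])
      show "\<exists>m N. k \<le> m \<and> 99 \<le> pdelta m N X Y" for k using jump ge by blast
    qed simp
    moreover have "\<not> E2 X Z"
    proof (rule not_E2_if_cofinal_jumps[of 98])
      fix k
      have "c (Suc (3 * k))" by (simp add: c_def mod_Suc)
      then have "98 \<le> pdelta (n (Suc (3 * k))) (n (Suc (Suc (3 * k)))) X Z" by (rule jump_xz)
      moreover have "k \<le> n (Suc (3 * k))" using ge[of "Suc (3 * k)"] by linarith
      ultimately show "\<exists>m N. k \<le> m \<and> 98 \<le> pdelta m N X Z" by blast
    qed simp
    moreover have "\<not> E2 Y Z"
    proof (rule not_E2_if_cofinal_jumps[of 98])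
      fix k
      have "\<not> c (Suc (Suc (3 * k)))" by (simp add: c_def mod_Suc)
      then have "98 \<le> pdelta (n (Suc (Suc (3 * k)))) (n (Suc (Suc (Suc (3 * k))))) Y Z" by (rule jump_yz)
      moreover have "k \<le> n (Suc (Suc (3 * k)))" using ge[of "Suc (Suc (3 * k))"] by linarith
      ultimately show "\<exists>m N. k \<le> m \<and> 98 \<le> pdelta m N Y Z" by blast
    qed simp
    ultimately have "(X, Y, Z) \<in> E2_triples A"
      using XYZ range E2_sym by (auto simp: E2_triples_def)
    moreover have "decode (X, Y, Z) = b"
      using decode_controlled[OF mono start lower upper yz xz] by (auto simp: c_def)
    ultimately show ?thesis by force
  qed
  then show ?thesis by blast
qed

section \<open>Continuity and definability of the decoding\<close>

text \<open>The Baire space coordinate \<open>f\<close> selects, for every \<open>i\<close>, a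
  closed piece of \<open>A i\<close> containing \<open>x\<close>; the set of such pairs is
  closed.\<close>

lemma Sigma11_INT_fsigma:
  fixes A :: "nat \<Rightarrow> 'a::topological_space set"
  assumes "\<And>i. fsigma_in euclidean (A i)"
  shows "Sigma11 (\<Inter>i. A i)"
proof -
  have "\<forall>i. \<exists>C :: nat \<Rightarrow> 'a set. (\<forall>n. closed (C n)) \<and> \<Union> (range C) = A i"
    using assms unfolding fsigma_in_ascending closed_closedin by meson
  then obtain C :: "nat \<Rightarrow> nat \<Rightarrow> 'a set" where C: "\<And>i n. closed (C i n)" "\<And>i. \<Union> (range (C i)) = A i"
    by metis
  define D :: "('a \<times> (nat \<Rightarrow> nat)) set" where "D = {(x, f). \<forall>i. x \<in> C i (f i)}"
  have D: "- D = (\<Union>i. \<Union>k. (- C i k) \<times> {f. f i = k})" by (auto simp: D_def)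
  have "open {f :: nat \<Rightarrow> nat. f i = k}" for i k
    using open_vimage[OF open_discrete[of "{k}"] continuous_on_product_coordinates[of i]]
    by (simp add: vimage_def)
  then have "open (- D)" unfolding D using C(1) by (intro open_UN ballI open_Times) auto
  moreover have "(\<Inter>i. A i) = fst ` D"
  proof (intro equalityI subsetI)
    fix x assume "x \<in> (\<Inter>i. A i)"
    then have "\<forall>i. \<exists>k. x \<in> C i k" using C(2) by blast
    then obtain f where "\<forall>i. x \<in> C i (f i)" by metis
    then have "(x, f) \<in> D" by (simp add: D_def)
    then show "x \<in> fst ` D" by force
  next
    fix x assume "x \<in> fst ` D"
    then obtain f where "(x, f) \<in> D" by force
    then have "\<And>i. x \<in> C i (f i)" by (simp add: D_def)
    then show "x \<in> (\<Inter>i. A i)" unfolding C(2)[symmetric] by blast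
  qed
  ultimately show ?thesis unfolding Sigma11_def closed_def by blast
qed

lemma open_if_finitely_determined:
  fixes S :: "((nat \<Rightarrow> bool) \<times> (nat \<Rightarrow> bool) \<times> (nat \<Rightarrow> bool)) set"
  assumes "\<And>x y z x' y' z'. agree N x x' \<Longrightarrow> agree N y y' \<Longrightarrow> agree N z z' \<Longrightarrow>
    (x, y, z) \<in> S \<Longrightarrow> (x', y', z') \<in> S"
  shows "open S"
proof (subst open_subopen, intro ballI)
  fix t assume t: "t \<in> S"
  obtain x y z where xyz: "t = (x, y, z)" by (metis prod_cases3)
  let ?T = "{x'. agree N x x'} \<times> {y'. agree N y y'} \<times> {z'. agree N z z'}"
  have "open ?T" by (intro open_Times open_agree)
  moreover have "t \<in> ?T" by (simp add: xyz)
  moreover have "?T \<subseteq> S" using assms t xyz by blast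
  ultimately show "\<exists>T. open T \<and> t \<in> T \<and> T \<subseteq> S" by blast
qed

text \<open>Fixing both passage times leaves a condition on finitely many coordinates, hence a
  clopen set.\<close>

definition decoded_at :: "nat \<Rightarrow> nat \<Rightarrow> nat \<Rightarrow> ((nat \<Rightarrow> bool) \<times> (nat \<Rightarrow> bool) \<times> (nat \<Rightarrow> bool)) set" where
  "decoded_at i m n = {(x, y, z). first_reach x y (100 * real (3 * i)) m \<and>
     first_reach x y (100 * real (Suc (3 * i))) n \<and> 50 \<le> pdelta m n x z}"

lemma decoded_at_agree:
  assumes "agree (max m n) x x'" "agree (max m n) y y'" "agree (max m n) z z'" "(x, y, z) \<in> decoded_at i m n"
  shows "(x', y', z') \<in> decoded_at i m n"
proof -
  have m: "agree m x x'" "agree m y y'" and n: "agree n x x'" "agree n y y'" "agree n z z'"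
    using assms agree_mono by (meson max.cobounded1 max.cobounded2)+
  then show ?thesis
    using assms(4) first_reach_agree[OF m] first_reach_agree[OF n(1,2)] pdelta_agree[OF n(1,3), of m]
    by (auto simp: decoded_at_def)
qed

lemma open_decoded_at: "open (decoded_at i m n)"
  by (rule open_if_finitely_determined) (rule decoded_at_agree)

lemma closed_decoded_at: "closed (decoded_at i m n)"
  unfolding closed_def
  by (rule open_if_finitely_determined[of "max m n"]) (metis ComplD ComplI agree_sym decoded_at_agree)

lemma decode_True_eq: "{t. decode t i} = (\<Union>m. \<Union>n. decoded_at i m n)"
  by (auto simp: decode_def decoded_at_def)

lemma fsigma_decode: "fsigma_in euclidean {t. decode t i = b}"
proof (cases b)
  case True
  have "fsigma_in euclidean (\<Union>m. \<Union>n. decoded_at i m n)"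
  proof (rule fsigma_in_Union)
    fix S assume "S \<in> range (\<lambda>m. \<Union>n. decoded_at i m n)"
    then obtain m where "S = (\<Union>n. decoded_at i m n)" by blast
    moreover have "fsigma_in euclidean (\<Union>n. decoded_at i m n)"
      by (rule fsigma_in_Union) (use closed_decoded_at[of i m] closed_imp_fsigma_in[of euclidean] in auto)
    ultimately show "fsigma_in euclidean S" by simp
  qed simp
  then show ?thesis using True by (simp add: decode_True_eq)
next
  case False
  have "open {t. decode t i}" unfolding decode_True_eq using open_decoded_at by blast
  then have "closed {t. \<not> decode t i}" by (simp add: closed_def Collect_neg_eq)
  then show ?thesis using False by (intro closed_imp_fsigma_in) (simp flip: closed_closedin)
qed

text \<open>The preimage of an open set is a countable union of preimages of cylinders, hence
  F-sigma; its complement is a countable intersection of F-sigma sets. Continuity can fail where a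
  passage time does not exist.\<close>

lemma Delta11_function_decode: "Delta11_function decode"
  unfolding Delta11_function_def
proof (intro allI impI)
  fix U :: "(nat \<Rightarrow> bool) set" assume U: "open U"
  let ?W = "{w. cyl w \<subseteq> U}"
  have U_eq: "x \<in> U \<longleftrightarrow> (\<exists>w. cyl w \<subseteq> U \<and> x \<in> cyl w)" for x
  proof
    assume "x \<in> U"
    then obtain n where "\<And>y. agree n x y \<Longrightarrow> y \<in> U" using open_imp_agree_ball[OF U] by metis
    then show "\<exists>w. cyl w \<subseteq> U \<and> x \<in> cyl w" by (intro exI[of _ "restr x n"]) (auto simp: cyl_restr)
  qed blast
  define B where "B w = {t. \<forall>i<length w. decode t i = w ! i}" for w
  have B: "decode t \<in> cyl w \<longleftrightarrow> t \<in> B w" for t w by (auto simp: cyl_def agree_def B_def)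
  have "fsigma_in euclidean {t. \<forall>i<n. decode t i = w ! i}" for w n
  proof (induction n)
    case 0
    have "fsigma_in euclidean (topspace euclidean)" by (rule fsigma_in_topspace)
    then show ?case by simp
  next
    case (Suc n)
    have eq: "{t. \<forall>i<Suc n. decode t i = w ! i} = {t. \<forall>i<n. decode t i = w ! i} \<inter> {t. decode t n = w ! n}"
      by (auto simp: less_Suc_eq)
    show ?case unfolding eq by (intro fsigma_in_Int Suc fsigma_decode)
  qed
  then have "fsigma_in euclidean (\<Union>w\<in>?W. B w)" unfolding B_def
    by (intro fsigma_in_Union countable_image countableI_type) blast
  moreover have "decode -` U = (\<Union>w\<in>?W. B w)" unfolding vimage_def U_eq B by blast
  ultimately have "Sigma11 (decode -` U)" using Sigma11_INT_fsigma[of "\<lambda>_. decode -` U"] by simp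
  moreover have "Sigma11 (- (decode -` U))"
  proof -
    define N where "N w = (if cyl w \<subseteq> U then \<Union>i<length w. {t. decode t i = (\<not> w ! i)} else UNIV)" for w
    have "fsigma_in euclidean (N w)" for w
    proof (cases "cyl w \<subseteq> U")
      case True
      then show ?thesis unfolding N_def by (auto intro!: fsigma_in_Union fsigma_decode)
    next
      case False
      then show ?thesis unfolding N_def using fsigma_in_topspace[of euclidean] by simp
    qed
    then have "Sigma11 (\<Inter>k. N (from_nat k))" by (intro Sigma11_INT_fsigma)
    moreover have "- (decode -` U) = (\<Inter>k. N (from_nat k))"
    proof -
      have "t \<in> - (decode -` U) \<longleftrightarrow> (\<forall>w. t \<in> N w)" for t
        using U_eq[of "decode t"] B[of t] by (auto simp: N_def B_def)
      moreover have "(\<forall>w. t \<in> N w) \<longleftrightarrow> (\<forall>k. t \<in> N (from_nat k))" for t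
        by (metis from_nat_to_nat)
      ultimately show ?thesis by blast
    qed
    ultimately show ?thesis by simp
  qed
  ultimately show "Delta11 (decode -` U)" by (simp add: Delta11_def Pi11_def)
qed

text \<open>Inequivalence of \<open>x\<close> and \<open>y\<close> makes both passage times exist,
  so every output bit is decided by finite prefixes of the triple.\<close>

lemma continuous_on_decode: "continuous_on (E2_triples UNIV) decode"
proof (rule continuous_on_coordinatewise_then_product)
  fix i
  show "continuous_on (E2_triples UNIV) (\<lambda>t. decode t i)"
    unfolding continuous_on_def
  proof
    fix t assume t: "t \<in> E2_triples UNIV"
    obtain x y z where xyz: "t = (x, y, z)" by (metis prod_cases3)
    then have "\<not> E2 x y" using t by (simp add: E2_triples_def)
    then have unb: "\<exists>n. r \<le> pdelta 0 n x y" for r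
      unfolding E2_iff_bounded by (meson linear)
    obtain m where m: "first_reach x y (100 * real (3 * i)) m" using unb first_reach_exists by metis
    obtain n where n: "first_reach x y (100 * real (Suc (3 * i))) n" using unb first_reach_exists by metis
    define N where "N = max m n"
    let ?T = "{x'. agree N x x'} \<times> {y'. agree N y y'} \<times> {z'. agree N z z'}"
    have eq: "decode (x', y', z') i \<longleftrightarrow> 50 \<le> pdelta m n x z"
      if "agree N x x'" "agree N y y'" "agree N z z'" for x' y' z'
    proof -
      have "agree m x x'" "agree m y y'" and n': "agree n x x'" "agree n y y'" "agree n z z'"
        using that agree_mono unfolding N_def by (meson max.cobounded1 max.cobounded2)+
      then have "first_reach x' y' (100 * real (3 * i)) m" "first_reach x' y' (100 * real (Suc (3 * i))) n"
        using first_reach_agree m n by blast+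
      then have "decode (x', y', z') i \<longleftrightarrow> 50 \<le> pdelta m n x' z'"
        unfolding decode_def prod.case using first_reach_unique by blast
      then show ?thesis using pdelta_agree[OF n'(1,3), of m] by simp
    qed
    have "decode t' i = decode t i" if "t' \<in> ?T" for t'
    proof -
      obtain x' y' z' where "t' = (x', y', z')" by (metis prod_cases3)
      then show ?thesis using that eq[of x' y' z'] eq[of x y z] xyz by simp
    qed
    moreover have "open ?T" "t \<in> ?T" using xyz by (auto intro!: open_Times open_agree)
    ultimately have "\<forall>\<^sub>F t' in at t within E2_triples UNIV. decode t' i = decode t i"
      unfolding eventually_at_topological by blast
    then show "((\<lambda>t. decode t i) \<longlongrightarrow> decode t i) (at t within E2_triples UNIV)"
      by (rule tendsto_eventually)
  qed
qed

theorem theorem16p4: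
  "(\<exists>Q :: (nat \<Rightarrow> bool) \<times> (nat \<Rightarrow> bool) \<times> (nat \<Rightarrow> bool) \<Rightarrow> (nat \<Rightarrow> bool).
      continuous_on (E2_triples UNIV) Q \<and>
      (\<forall>p. E2_tree p \<longrightarrow> Q ` E2_triples (branches p) = UNIV)) \<and>
   (\<exists>K :: (nat \<Rightarrow> bool) \<times> (nat \<Rightarrow> bool) \<times> (nat \<Rightarrow> bool) \<Rightarrow> (nat \<Rightarrow> bool).
      Delta11_function K \<and>
      (\<forall>A. Sigma11 A \<and> Delta11_reducible E2 E2 A \<longrightarrow> K ` E2_triples A = UNIV))"
proof -
  have "Delta11_reducible E2 E2 (branches p)" if "E2_tree p" for p
    using that unfolding E2_tree_def Delta11_reducible_def by (elim exE conjE) (rule exI)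
  then have "\<forall>p. E2_tree p \<longrightarrow> decode ` E2_triples (branches p) = UNIV"
    using decode_surjective by simp
  moreover have "\<forall>A. Sigma11 A \<and> Delta11_reducible E2 E2 A \<longrightarrow> decode ` E2_triples A = UNIV"
    using decode_surjective by simp
  ultimately show ?thesis
    by (intro conjI exI[of _ decode] continuous_on_decode Delta11_function_decode)
qed

end
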